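(* Let $0<\beta\le 1$, $\lambda>0$, and let $Q_\beta^f(t)=N_\beta(D_f(t))$, $t\ge 0$, where $\{N_\beta(t)\}_{t\ge0}$ is the fractional Poisson process with parameters $\beta,\lambda$ and $\{D_f(t)\}_{t\ge0}$ is a subordinator independent of it with $\mathbb{E}[(D_f(t))^\rho]<\infty$ for all $\rho>0$. Let $0<s\le t<\infty$, $q=\lambda/\Gamma(1+\beta)$ and $d=\beta q^2B(\beta,1+\beta)$. Then: (i) $\mathbb{E}[Q_\beta^f(t)]=q\,\mathbb{E}[D_f^\beta(t)]$; (ii) $\mathrm{Var}[Q_\beta^f(t)]=q\,\mathbb{E}[D_f^\beta(t)]\big(1-q\,\mathbb{E}[D_f^\beta(t)]\big)+2d\,\mathbb{E}[D_f^{2\beta}(t)]$; (iii) $\displaystyle \mathrm{Cov}[Q_\beta^f(s),Q_\beta^f(t)]=q\,\mathbb{E}[D_f^\beta(s)]+d\,\mathbb{E}[D_f^{2\beta}(s)]-q^2\,\mathbb{E}[D_f^\beta(s)]\,\mathbb{E}[D_f^\beta(t)]+q^2\beta\,\mathbb{E}\left[D_f^{2\beta}(t)\,B\left(\beta,1+\beta;\frac{D_f(s)}{D_f(t)}\right)\right].$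
   Context: Notation: $D_f^\rho(t)=(D_f(t))^\rho$; $B(a,b;x)=\int_0^x u^{a-1}(1-u)^{b-1}\,du$ is the incomplete beta function and $B(a,b)=B(a,b;1)$. Subordinator: $\{D_f(t)\}_{t\ge 0}$ is a nondecreasing Lévy process with $D_f(0)=0$ a.s. and $\mathbb{E}[e^{-sD_f(t)}]=e^{-tf(s)}$, $s>0$, where $f$ is the Bernstein function $f(s)=bs+\int_0^\infty(1-e^{-sx})\,\nu(dx)$, with $b\ge0$ and $\nu$ a non-negative Lévy measure on $(0,\infty)$ satisfying $\int_0^\infty (x\wedge1)\,\nu(dx)<\infty$ and $\nu(0,\infty)=\infty$ (so sample paths are a.s. strictly increasing). Fractional Poisson process (FPP): for $0<\beta<1$, let $\{D_\beta(t)\}$ be the $\beta$-stable subordinator, $\mathbb{E}[e^{-sD_\beta(t)}]=e^{-ts^\beta}$, and $E_\beta(t)=\inf\{r\ge0: D_\beta(r)>t\}$ the inverse $\beta$-stable subordinator. The FPP is $N_\beta(t)=N_\beta(t,\lambda)=N(E_\beta(t),\lambda)$, where $\{N(t,\lambda)\}$ is a Poisson process of rate $\lambda>0$ independent of $E_\beta$. For $\beta=1$ the FPP is the Poisson process of rate $\lambda$. *)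

theory Defs
  imports "HOL-Probability.Probability"
begin

definition incomplete_beta :: "real \<Rightarrow> real \<Rightarrow> real \<Rightarrow> real" where
  "incomplete_beta a b x = (LBINT u:{0..x}. u powr (a - 1) * (1 - u) powr (b - 1))"

definition levy_measure :: "real measure \<Rightarrow> bool" where
  "levy_measure \<nu> \<longleftrightarrow>
     sets \<nu> = sets (restrict_space borel {0<..}) \<and>
     (\<integral>\<^sup>+ x. ennreal (min x 1) \<partial>\<nu>) < \<infinity>"

definition bernstein_fun :: "real \<Rightarrow> real measure \<Rightarrow> real \<Rightarrow> real" where
  "bernstein_fun b \<nu> s = b * s + (\<integral>x. 1 - exp (- s * x) \<partial>\<nu>)"

text \<open>Processes are functions of type \<open>real \<Rightarrow> 'a \<Rightarrow> real\<close>; only their values at times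
  \<open>t \<ge> 0\<close> are constrained.\<close>

definition inverse_process :: "(real \<Rightarrow> 'a \<Rightarrow> real) \<Rightarrow> real \<Rightarrow> 'a \<Rightarrow> real" where
  "inverse_process D t \<omega> = Inf {r. 0 \<le> r \<and> t < D r \<omega>}"

context prob_space
begin

definition covariance :: "('a \<Rightarrow> real) \<Rightarrow> ('a \<Rightarrow> real) \<Rightarrow> real" where
  "covariance X Y = expectation (\<lambda>\<omega>. (X \<omega> - expectation X) * (Y \<omega> - expectation Y))"

definition stochastic_process :: "(real \<Rightarrow> 'a \<Rightarrow> real) \<Rightarrow> bool" where
  "stochastic_process X \<longleftrightarrow> (\<forall>t\<ge>0. random_variable borel (X t))"

text \<open>Independence of the sigma-algebras generated by the whole families \<open>(X t)\<close> and \<open>(Y t)\<close>,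
  \<open>t \<ge> 0\<close>. As in \<^const>\<open>indep_var\<close>, this includes that both are stochastic processes.\<close>

definition indep_processes :: "(real \<Rightarrow> 'a \<Rightarrow> real) \<Rightarrow> (real \<Rightarrow> 'a \<Rightarrow> real) \<Rightarrow> bool" where
  "indep_processes X Y \<longleftrightarrow>
     indep_var (PiM {0..} (\<lambda>_. borel)) (\<lambda>\<omega>. \<lambda>t\<in>{0..}. X t \<omega>)
               (PiM {0..} (\<lambda>_. borel)) (\<lambda>\<omega>. \<lambda>t\<in>{0..}. Y t \<omega>)"

text \<open>Stochastic continuity is not listed, since it follows from stationarity of the increments
  and right-continuity of the paths. Path properties are only required almost surely.\<close>

definition levy_process :: "(real \<Rightarrow> 'a \<Rightarrow> real) \<Rightarrow> bool" where
  "levy_process X \<longleftrightarrow>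
     stochastic_process X \<and>
     (AE \<omega> in M. X 0 \<omega> = 0) \<and>
     (\<forall>(\<tau> :: nat \<Rightarrow> real) n. 0 \<le> \<tau> 0 \<and> incseq \<tau> \<longrightarrow>
        indep_vars (\<lambda>_. borel) (\<lambda>i \<omega>. X (\<tau> (Suc i)) \<omega> - X (\<tau> i) \<omega>) {..<n}) \<and>
     (\<forall>s\<ge>0. \<forall>h\<ge>0. distr M borel (\<lambda>\<omega>. X (s + h) \<omega> - X s \<omega>) = distr M borel (X h)) \<and>
     (AE \<omega> in M.
        (\<forall>t\<ge>0. continuous (at_right t) (\<lambda>r. X r \<omega>)) \<and>
        (\<forall>t>0. \<exists>l. ((\<lambda>r. X r \<omega>) \<longlongrightarrow> l) (at_left t)))"

definition subordinator :: "(real \<Rightarrow> real) \<Rightarrow> (real \<Rightarrow> 'a \<Rightarrow> real) \<Rightarrow> bool" where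
  "subordinator f D \<longleftrightarrow>
     levy_process D \<and>
     (AE \<omega> in M. mono_on {0..} (\<lambda>t. D t \<omega>)) \<and>
     (\<forall>t\<ge>0. \<forall>s>0. expectation (\<lambda>\<omega>. exp (- s * D t \<omega>)) = exp (- t * f s))"

definition stable_subordinator :: "real \<Rightarrow> (real \<Rightarrow> 'a \<Rightarrow> real) \<Rightarrow> bool" where
  "stable_subordinator \<beta> D \<longleftrightarrow> subordinator (\<lambda>s. s powr \<beta>) D"

text \<open>The law is prescribed only for \<open>t > 0\<close> because \<^const>\<open>poisson_pmf\<close> is specified only for
  positive rates; at \<open>t = 0\<close> the value is almost surely \<open>0\<close>.\<close>

definition poisson_process :: "real \<Rightarrow> (real \<Rightarrow> 'a \<Rightarrow> real) \<Rightarrow> bool" where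
  "poisson_process lam N \<longleftrightarrow>
     levy_process N \<and>
     (\<forall>t>0. distr M borel (N t) = distr (measure_pmf (poisson_pmf (lam * t))) borel real)"

definition fractional_poisson_process ::
  "real \<Rightarrow> real \<Rightarrow> (real \<Rightarrow> 'a \<Rightarrow> real) \<Rightarrow> bool" where
  "fractional_poisson_process \<beta> lam N\<beta> \<longleftrightarrow>
     (if \<beta> = 1 then poisson_process lam N\<beta>
      else \<exists>N D. poisson_process lam N \<and> stable_subordinator \<beta> D \<and>
             indep_processes N (inverse_process D) \<and>
             (\<forall>t\<ge>0. \<forall>\<omega>\<in>space M. N\<beta> t \<omega> = N (inverse_process D t \<omega>) \<omega>))"

end

end

theory Submission
  imports Defs
begin

text \<open>
  A right-continuous process evaluated at an independent random time can be averaged by first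
  freezing the time (Tonelli). Applied twice, to \<open>N\<close> with the times \<open>E\<^sub>\<beta>(x)\<close> and then to
  \<open>N\<^sub>\<beta>\<close> with the times \<open>D\<^sub>f(t)\<close>, this reduces everything to the first two moments of the inverse
  stable subordinator \<open>E\<^sub>\<beta>\<close>. Now \<open>E\<^sub>\<beta>(x)\<close> is the time that \<open>D\<^sub>\<beta>\<close> spends in \<open>[0, x]\<close>, so its mean is
  \<open>U[0, x]\<close> for the potential measure \<open>U\<close> of \<open>D\<^sub>\<beta>\<close>, and by the independence and stationarity of the
  increments \<open>E[E\<^sub>\<beta>(x) E\<^sub>\<beta>(y)] = G(x, y) + G(y, x)\<close> with
  \<open>G(x, y) = (U \<otimes> U) {(a, b). a \<le> x \<and> a + b \<le> y}\<close>. The Laplace transform of \<open>U\<close> is \<open>s powr (-\<beta>)\<close>,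
  whence \<open>U\<close> has the density \<open>z powr (\<beta> - 1) / Gamma \<beta>\<close>, and \<open>G\<close> is an incomplete beta function.
\<close>

section \<open>Uniqueness of Laplace transforms\<close>

text \<open>Processes are measurable only time by time and regular only almost surely, so neither a
  value at a random time nor an integral along a path is measurable for free; this obstacle forces
  \<open>right_value\<close> and \<open>regularized\<close>. For a similar reason the infimum
  defining the inverse is traded for an occupation time, to which Tonelli applies. All moments are
  computed in \<open>ennreal\<close>, so integrability comes out as a result instead of going in as
  a side condition. For \<open>x \<le> y\<close> one has \<open>G(y, x) = G(x, x)\<close>, because
  increments are nonnegative; this is the source of the complete beta function next to the
  incomplete one. The constants: \<open>U[0, x]\<close> is
  \<open>x powr \<beta> / Gamma (1 + \<beta>)\<close>, whence \<open>q\<close>. The convolution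
  carries \<open>1 / (Gamma \<beta> * Gamma (1 + \<beta>))\<close>, that is
  \<open>\<beta> / (Gamma (1 + \<beta>))\<^sup>2\<close>, and multiplied by
  \<open>lam\<^sup>2\<close> this is the factor \<open>q\<^sup>2 * \<beta>\<close>. For
  \<open>\<beta> = 1\<close> the process is Poisson by definition and there is no inverse to average
  over, so the general formulas are checked to specialise to the Poisson ones.\<close>

lemma abs_cts_step_le_1: "a < b \<Longrightarrow> \<bar>cts_step a b x\<bar> \<le> 1"
  by (auto simp: cts_step_def)

lemma borel_measurable_cts_step[measurable]: "cts_step a b \<in> borel_measurable borel"
  unfolding cts_step_def[abs_def] by measurable

text \<open>The ramps that fall from 1 at \<open>c\<close> to 0 at \<open>c + 1 / Suc n\<close>
  converge pointwise to the indicator of \<open>{..c}\<close>. Dominated convergence then recovers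
  the distribution function.\<close>

lemma finite_borel_measure_eqI_cts_step:
  assumes "finite_borel_measure M" "finite_borel_measure N"
    and eq: "\<And>a b. a < b \<Longrightarrow> (\<integral>x. cts_step a b x \<partial>M) = (\<integral>x. cts_step a b x \<partial>N)"
  shows "M = N"
proof (rule cdf_unique'[OF assms(1,2)], rule ext)
  fix c :: real
  have lim: "(\<lambda>n. \<integral>x. cts_step c (c + 1 / Suc n) x \<partial>K) \<longlonglongrightarrow> cdf K c"
    if "finite_borel_measure K" for K
  proof -
    interpret finite_borel_measure K by fact
    have pt: "(\<lambda>n. cts_step c (c + 1 / Suc n) x) \<longlonglongrightarrow> indicator {..c} x" for x
    proof (cases "x \<le> c")
      case False
      have "(\<lambda>n. c + 1 / Suc n) \<longlonglongrightarrow> c + 0"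
        by (intro tendsto_intros LIMSEQ_Suc lim_1_over_n)
      then have "eventually (\<lambda>n. c + 1 / Suc n < x) sequentially"
        using False by (intro order_tendstoD(2)[of _ "c"]) auto
      then have "eventually (\<lambda>n. cts_step c (c + 1 / Suc n) x = 0) sequentially"
        by eventually_elim (use False in \<open>auto simp: cts_step_def\<close>)
      then show ?thesis using False by (simp add: tendsto_eventually)
    qed (simp add: cts_step_def)
    have "(\<lambda>n. \<integral>x. cts_step c (c + 1 / Suc n) x \<partial>K) \<longlonglongrightarrow> (\<integral>x. indicator {..c} x \<partial>K)"
    proof (rule integral_dominated_convergence[where w="\<lambda>_. 1"])
      show "cts_step c (c + 1 / Suc n) \<in> borel_measurable K" for n
        by (simp cong: measurable_cong_sets[OF M_is_borel refl])
      show "AE x in K. norm (cts_step c (c + 1 / Suc n) x) \<le> 1" for n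
        by (simp add: abs_cts_step_le_1 del: of_nat_Suc)
    qed (use pt in \<open>auto cong: measurable_cong_sets[OF M_is_borel refl]\<close>)
    then show ?thesis by (simp add: cdf_def M_is_borel sets_eq_imp_space_eq[OF M_is_borel])
  qed
  have "(\<lambda>n. \<integral>x. cts_step c (c + 1 / Suc n) x \<partial>M) = (\<lambda>n. \<integral>x. cts_step c (c + 1 / Suc n) x \<partial>N)"
    by (intro ext eq) simp
  with lim[OF assms(1)] lim[OF assms(2)] show "cdf M c = cdf N c"
    using LIMSEQ_unique by metis
qed

text \<open>Uniqueness in the Hausdorff moment problem. By Stone-Weierstrass a ramp is uniformly
  close on the unit interval to a polynomial, whose integrals are combinations of moments; the error
  is at most the uniform distance times the two total masses.\<close>

lemma moments_unique:
  assumes M: "finite_borel_measure M" "AE x in M. x \<in> {0..1}"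
    and N: "finite_borel_measure N" "AE x in N. x \<in> {0..1}"
    and eq: "\<And>n. (\<integral>x. x ^ n \<partial>M) = (\<integral>x. x ^ n \<partial>N)"
  shows "M = N"
proof (rule finite_borel_measure_eqI_cts_step[OF M(1) N(1)])
  fix a b :: real assume "a < b"
  define f where "f = cts_step a b"
  have cf: "continuous_on UNIV f" unfolding f_def
    by (intro uniformly_continuous_imp_continuous cts_step_uniformly_continuous \<open>a < b\<close>)
  have int_pow: "integrable K (\<lambda>x. x ^ n)" and int_f: "integrable K f"
    if "finite_borel_measure K" "AE x in K. x \<in> {0..1}" for K n
  proof -
    interpret finite_borel_measure K by fact
    have [measurable]: "f \<in> borel_measurable K"
      using borel_measurable_continuous_onI[OF cf] by (simp cong: measurable_cong_sets[OF M_is_borel refl])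
    show "integrable K (\<lambda>x. x ^ n)"
    proof (rule integrable_const_bound[of _ 1])
      show "AE x in K. norm (x ^ n) \<le> 1"
        using that(2) by eventually_elim (auto simp: power_le_one)
    qed (auto cong: measurable_cong_sets[OF M_is_borel refl])
    show "integrable K f"
      by (rule integrable_const_bound[of _ 1]) (auto simp: f_def abs_cts_step_le_1 \<open>a < b\<close> cong: measurable_cong_sets[OF M_is_borel refl])
  qed
  have bound: "\<bar>(\<integral>x. f x \<partial>M) - (\<integral>x. f x \<partial>N)\<bar> \<le> e * (measure M (space M) + measure N (space N))"
    if "e > 0" for e
  proof -
    obtain g where g: "real_polynomial_function g" "\<And>x. x \<in> {0..1} \<Longrightarrow> \<bar>f x - g x\<bar> < e"
      using Stone_Weierstrass_real_polynomial_function[of "{0..1}" f e] \<open>e > 0\<close> cf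
      by (metis compact_Icc continuous_on_subset subset_UNIV)
    obtain c n where g_eq: "g = (\<lambda>x. \<Sum>i\<le>n. c i * x ^ i)"
      using g(1) by (auto simp: real_polynomial_function_iff_sum)
    have near: "\<bar>(\<integral>x. f x \<partial>K) - (\<integral>x. g x \<partial>K)\<bar> \<le> e * measure K (space K)"
      and int_g: "(\<integral>x. g x \<partial>K) = (\<Sum>i\<le>n. c i * (\<integral>x. x ^ i \<partial>K))"
      if K: "finite_borel_measure K" "AE x in K. x \<in> {0..1}" for K
    proof -
      interpret finite_borel_measure K by fact
      have ig: "integrable K g"
        unfolding g_eq using int_pow[OF K] by auto
      show "(\<integral>x. g x \<partial>K) = (\<Sum>i\<le>n. c i * (\<integral>x. x ^ i \<partial>K))"
        unfolding g_eq using int_pow[OF K] by simp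
      have "\<bar>(\<integral>x. f x \<partial>K) - (\<integral>x. g x \<partial>K)\<bar> = \<bar>\<integral>x. f x - g x \<partial>K\<bar>"
        using int_f[OF K] ig by simp
      also have "\<dots> \<le> (\<integral>x. \<bar>f x - g x\<bar> \<partial>K)"
        by (rule integral_abs_bound)
      also have "\<dots> \<le> (\<integral>x. e \<partial>K)"
      proof (rule integral_mono_AE)
        show "AE x in K. \<bar>f x - g x\<bar> \<le> e"
          using K(2) by eventually_elim (use g(2) in \<open>auto intro: less_imp_le\<close>)
      qed (use int_f[OF K] ig in auto)
      finally show "\<bar>(\<integral>x. f x \<partial>K) - (\<integral>x. g x \<partial>K)\<bar> \<le> e * measure K (space K)"
        by (simp add: mult.commute)
    qed
    have "(\<integral>x. g x \<partial>M) = (\<integral>x. g x \<partial>N)"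
      using int_g[OF M] int_g[OF N] eq by simp
    with near[OF M] near[OF N] show ?thesis
      by (simp add: distrib_left)
  qed
  have small: "\<bar>(\<integral>x. f x \<partial>M) - (\<integral>x. f x \<partial>N)\<bar> \<le> e" if "e > 0" for e
  proof -
    define m where "m = measure M (space M) + measure N (space N)"
    have "m \<ge> 0" by (simp add: m_def)
    \<comment> \<open>Dividing by \<open>m + 1\<close> instead of \<open>m\<close> covers the case
      that both measures are zero.\<close>
    have "e / (m + 1) * m \<le> e"
      using \<open>m \<ge> 0\<close> \<open>e > 0\<close> by (simp add: divide_simps)
    moreover have "\<bar>(\<integral>x. f x \<partial>M) - (\<integral>x. f x \<partial>N)\<bar> \<le> e / (m + 1) * m"
      unfolding m_def using \<open>m \<ge> 0\<close> \<open>e > 0\<close> by (intro bound) (simp add: m_def add_nonneg_pos)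
    ultimately show ?thesis by linarith
  qed
  have "\<bar>(\<integral>x. f x \<partial>M) - (\<integral>x. f x \<partial>N)\<bar> \<le> 0"
    by (rule field_le_epsilon) (use small in auto)
  then show "(\<integral>x. cts_step a b x \<partial>M) = (\<integral>x. cts_step a b x \<partial>N)"
    by (simp add: f_def)
qed

lemma laplace_unique:
  fixes U V :: "real measure"
  assumes U: "sets U = sets borel" "AE x in U. 0 \<le> x"
    and V: "sets V = sets borel" "AE x in V. 0 \<le> x"
    and eq: "\<And>n. (\<integral>\<^sup>+x. ennreal (exp (- real (Suc n) * x)) \<partial>U) = (\<integral>\<^sup>+x. ennreal (exp (- real (Suc n) * x)) \<partial>V)"
    and fin: "(\<integral>\<^sup>+x. ennreal (exp (- x)) \<partial>U) < \<infinity>"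
  shows "U = V"
proof -
  \<comment> \<open>Under \<open>x \<mapsto> exp (- x)\<close> the Laplace transform at the integers becomes the moments of a
    finite measure on the unit interval.\<close>
  define T where "T = (\<lambda>K :: real measure. distr (density K (\<lambda>x. ennreal (exp (- x)))) borel (\<lambda>x. exp (- x)))"
  have T: "finite_borel_measure (T K)" "AE x in T K. x \<in> {0..1}"
       "(\<integral>x. x ^ n \<partial>T K) = enn2real (\<integral>\<^sup>+x. ennreal (exp (- real (Suc n) * x)) \<partial>K)"
       "K = density (distr (T K) borel (\<lambda>y. - ln y)) (\<lambda>x. ennreal (exp x))"
    if K: "sets K = sets borel" "AE x in K. 0 \<le> x" "(\<integral>\<^sup>+x. ennreal (exp (- x)) \<partial>K) < \<infinity>"
    for K n
  proof -
    note [measurable_cong] = K(1)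
    show "finite_borel_measure (T K)"
      by (rule finite_borel_measure.intro; (rule finite_measureI)?; (unfold_locales)?)
         (use K in \<open>auto simp: T_def emeasure_distr emeasure_density space_density\<close>)
    show "AE x in T K. x \<in> {0..1}"
      unfolding T_def using K(2) by (subst AE_distr_iff) (auto simp: AE_density)
    show "(\<integral>x. x ^ n \<partial>T K) = enn2real (\<integral>\<^sup>+x. ennreal (exp (- real (Suc n) * x)) \<partial>K)"
    proof -
      have "(\<integral>x. x ^ n \<partial>T K) = (\<integral>x. exp (- x) * exp (- x) ^ n \<partial>K)"
        unfolding T_def by (simp add: integral_distr integral_density)
      also have "\<dots> = (\<integral>x. exp (- real (Suc n) * x) \<partial>K)"
        by (intro Bochner_Integration.integral_cong refl)
           (simp add: exp_of_nat_mult[symmetric] exp_add[symmetric] algebra_simps)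
      also have "\<dots> = enn2real (\<integral>\<^sup>+x. ennreal (exp (- real (Suc n) * x)) \<partial>K)"
        by (intro integral_eq_nn_integral) auto
      finally show ?thesis .
    qed
    \<comment> \<open>The map \<open>T\<close> can be inverted: \<open>- ln y\<close> undoes the
      change of variable and the density \<open>exp x\<close> undoes the tilt. The measure may
      itself be infinite; only the tilted one must be finite. The tilt uses up one factor
      \<open>exp (- x)\<close>, so the moment of order \<open>n\<close> is the transform at
      \<open>Suc n\<close>.\<close>
    have "distr (T K) borel (\<lambda>y. - ln y) = density K (\<lambda>x. ennreal (exp (- x)))"
      unfolding T_def by (subst distr_distr) (auto simp: comp_def K(1) intro!: distr_id2)
    then show "K = density (distr (T K) borel (\<lambda>y. - ln y)) (\<lambda>x. ennreal (exp x))"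
      by (simp add: density_density_eq ennreal_mult'[symmetric] exp_add[symmetric] density_1)
  qed
  have finV: "(\<integral>\<^sup>+x. ennreal (exp (- x)) \<partial>V) < \<infinity>"
    using eq[of 0] fin by simp
  have "T U = T V"
    using T[OF U fin] T[OF V finV] eq by (intro moments_unique) auto
  then show ?thesis
    using T(4)[OF U fin] T(4)[OF V finV] by simp
qed

section \<open>Processes at independent random times\<close>

text \<open>
  The value at \<open>t\<close> of a right-continuous path is recovered from countably many
  coordinates, which makes the evaluation jointly measurable in time and path. On other
  paths this is junk, since \<^const>\<open>lim\<close> is then unspecified.
\<close>

definition right_value :: "real \<Rightarrow> (real \<Rightarrow> real) \<Rightarrow> real" where
  "right_value t w = lim (\<lambda>n. w ((real (nat \<lfloor>t * real (Suc n)\<rfloor>) + 1) / real (Suc n)))"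

text \<open>The floor keeps the sampling times within \<open>1 / Suc n\<close> of \<open>t\<close>,
  and the added 1 keeps them strictly to its right, as convergence in \<open>at_right t\<close>
  demands.\<close>

lemma right_value_eq:
  assumes "continuous (at_right t) w" "0 \<le> t"
  shows "right_value t w = w t"
proof -
  define g where "g = (\<lambda>n. (real (nat \<lfloor>t * real (Suc n)\<rfloor>) + 1) / real (Suc n))"
  have g: "t < g n" "g n \<le> t + 1 / Suc n" for n
  proof -
    have "real (nat \<lfloor>t * real (Suc n)\<rfloor>) = of_int \<lfloor>t * real (Suc n)\<rfloor>"
      using assms(2) by (simp add: zero_le_floor)
    then have *: "real (nat \<lfloor>t * real (Suc n)\<rfloor>) \<le> t * real (Suc n)"
       "t * real (Suc n) < real (nat \<lfloor>t * real (Suc n)\<rfloor>) + 1"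
      by linarith+
    from *(2) show "t < g n" by (simp add: g_def pos_less_divide_eq del: of_nat_Suc)
    from *(1) have "g n \<le> (t * real (Suc n) + 1) / real (Suc n)"
      unfolding g_def by (intro divide_right_mono) auto
    also have "\<dots> = t + 1 / Suc n" by (simp add: field_simps)
    finally show "g n \<le> t + 1 / Suc n" .
  qed
  have "(\<lambda>n. t + 1 / Suc n) \<longlonglongrightarrow> t + 0"
    by (intro tendsto_intros LIMSEQ_Suc lim_1_over_n)
  then have "g \<longlonglongrightarrow> t"
    by (intro tendsto_sandwich[of "\<lambda>_. t" g sequentially "\<lambda>n. t + 1 / Suc n"])
       (use g in \<open>auto intro!: always_eventually less_imp_le\<close>)
  then have "filterlim g (at_right t) sequentially"
    using g(1) by (auto simp: filterlim_at intro!: always_eventually)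
  then have "(\<lambda>n. w (g n)) \<longlonglongrightarrow> w t"
    using assms(1) unfolding continuous_within by (rule filterlim_compose[rotated])
  then show ?thesis unfolding right_value_def g_def by (rule limI)
qed

text \<open>Because of \<open>nat\<close> the sampling times are nonnegative for every
  \<open>t\<close>, so the path is never read at negative times.\<close>

lemma right_value_restrict: "right_value t (restrict w {0..}) = right_value t w"
  by (simp add: right_value_def)

text \<open>At each stage the sampling index ranges over the naturals, so the evaluation is glued
  from countably many coordinate maps.\<close>

lemma measurable_right_value[measurable]:
  "(\<lambda>(t, w). right_value t w) \<in> borel_measurable (borel \<Otimes>\<^sub>M PiM {0..} (\<lambda>_. borel))"
proof -
  have "(\<lambda>x. snd x ((real (nat \<lfloor>fst x * real (Suc n)\<rfloor>) + 1) / real (Suc n)))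
      \<in> borel_measurable (borel \<Otimes>\<^sub>M PiM {0..} (\<lambda>_. borel :: real measure))" for n
  proof (rule measurable_compose_countable[where g="\<lambda>x. nat \<lfloor>fst x * real (Suc n)\<rfloor>"
        and f="\<lambda>i x. snd x ((real i + 1) / real (Suc n))"])
    fix i :: nat
    show "(\<lambda>x. snd x ((real i + 1) / real (Suc n)))
       \<in> borel_measurable (borel \<Otimes>\<^sub>M PiM {0..} (\<lambda>_. borel :: real measure))"
      by (rule measurable_compose[OF measurable_snd measurable_component_singleton]) auto
  qed measurable
  then show ?thesis
    unfolding right_value_def case_prod_beta by measurable
qed

lemma (in prob_space) indep_processes_rv:
  assumes "indep_processes X Y" "0 \<le> t"
  shows "random_variable borel (X t)" "random_variable borel (Y t)"
proof -
  have X: "random_variable (PiM {0..} (\<lambda>_. borel)) (\<lambda>\<omega>. \<lambda>t\<in>{0..}. X t \<omega>)"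
    and Y: "random_variable (PiM {0..} (\<lambda>_. borel)) (\<lambda>\<omega>. \<lambda>t\<in>{0..}. Y t \<omega>)"
    using assms(1) unfolding indep_processes_def by (auto dest: indep_var_rv1 indep_var_rv2)
  have "(\<lambda>w. w t) \<in> measurable (PiM {0..} (\<lambda>_. borel)) (borel :: real measure)"
    using assms(2) by (intro measurable_component_singleton) auto
  from measurable_compose[OF X this] measurable_compose[OF Y this] assms(2)
  show "random_variable borel (X t)" "random_variable borel (Y t)"
    by auto
qed

text \<open>The joint law of the two whole paths is a product measure, and through
  \<open>right_value\<close> the evaluation of \<open>N\<close> at two random times is a measurable
  function on that product. Two times are treated at once for the sake of product moments;
  \<open>X\<close> enters only through its coordinates at \<open>s\<close> and
  \<open>t\<close>.\<close>

lemma (in prob_space) indep_processes_nn_integral: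
  fixes h :: "real \<Rightarrow> real \<Rightarrow> ennreal"
  assumes ind: "indep_processes N X"
    and rc: "AE \<omega> in M. \<forall>t\<ge>0. continuous (at_right t) (\<lambda>r. N r \<omega>)"
    and st: "0 \<le> s" "0 \<le> t"
    and nn: "AE \<omega> in M. 0 \<le> X s \<omega>" "AE \<omega> in M. 0 \<le> X t \<omega>"
    and h: "(\<lambda>(x, y). h x y) \<in> borel_measurable (borel \<Otimes>\<^sub>M borel)"
  shows "(\<integral>\<^sup>+\<omega>. h (N (X s \<omega>) \<omega>) (N (X t \<omega>) \<omega>) \<partial>M) =
    (\<integral>\<^sup>+\<omega>'. \<integral>\<^sup>+\<omega>. h (N (X s \<omega>') \<omega>) (N (X t \<omega>') \<omega>) \<partial>M \<partial>M)"
proof -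
  define P where "P = PiM {0 :: real..} (\<lambda>_. borel :: real measure)"
  define Y where "Y = (\<lambda>\<omega>. \<lambda>r\<in>{0..}. N r \<omega>)"
  define Z where "Z = (\<lambda>\<omega>. \<lambda>r\<in>{0..}. X r \<omega>)"
  have Y[measurable]: "Y \<in> measurable M P" and Z[measurable]: "Z \<in> measurable M P"
    and d: "distr M P Y \<Otimes>\<^sub>M distr M P Z = distr M (P \<Otimes>\<^sub>M P) (\<lambda>\<omega>. (Y \<omega>, Z \<omega>))"
    using ind unfolding indep_processes_def P_def[symmetric] Y_def[symmetric] Z_def[symmetric]
    by (auto simp: indep_var_distribution_eq)
  interpret Y: prob_space "distr M P Y" by (rule prob_space_distr) fact
  interpret Z: prob_space "distr M P Z" by (rule prob_space_distr) fact
  interpret YZ: pair_prob_space "distr M P Y" "distr M P Z" ..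
  define H where "H = (\<lambda>(y, z). h (right_value (z s) y) (right_value (z t) y))"
  have comp[measurable]: "(\<lambda>z. z r) \<in> borel_measurable P" if "0 \<le> r" for r
    unfolding P_def using that by (intro measurable_component_singleton) auto
  have rv[measurable]: "(\<lambda>p. right_value (snd p r) (fst p)) \<in> borel_measurable (P \<Otimes>\<^sub>M P)" if "0 \<le> r" for r
  proof -
    have "(\<lambda>p. (snd p r, fst p)) \<in> measurable (P \<Otimes>\<^sub>M P) (borel \<Otimes>\<^sub>M P)"
      using that by measurable
    from measurable_compose[OF this measurable_right_value[folded P_def]] show ?thesis
      by simp
  qed
  have H[measurable]: "H \<in> borel_measurable (P \<Otimes>\<^sub>M P)"
    using measurable_compose[OF measurable_Pair[OF rv[OF st(1)] rv[OF st(2)]] h]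
    by (simp add: H_def case_prod_beta)
  have "(\<integral>\<^sup>+\<omega>. h (N (X s \<omega>) \<omega>) (N (X t \<omega>) \<omega>) \<partial>M) = (\<integral>\<^sup>+\<omega>. H (Y \<omega>, Z \<omega>) \<partial>M)"
  proof (rule nn_integral_cong_AE)
    show "AE \<omega> in M. h (N (X s \<omega>) \<omega>) (N (X t \<omega>) \<omega>) = H (Y \<omega>, Z \<omega>)"
      using rc nn
      by eventually_elim (use st in \<open>simp add: H_def Y_def Z_def right_value_restrict right_value_eq\<close>)
  qed
  also have "\<dots> = integral\<^sup>N (distr M P Y \<Otimes>\<^sub>M distr M P Z) H"
    unfolding d by (subst nn_integral_distr) auto
  also have "\<dots> = (\<integral>\<^sup>+y. \<integral>\<^sup>+z. H (y, z) \<partial>distr M P Z \<partial>distr M P Y)"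
    by (rule Z.nn_integral_fst[symmetric]) simp
  also have "\<dots> = (\<integral>\<^sup>+z. \<integral>\<^sup>+y. H (y, z) \<partial>distr M P Y \<partial>distr M P Z)"
    by (rule YZ.Fubini[symmetric]) simp
  also have "\<dots> = (\<integral>\<^sup>+\<omega>'. \<integral>\<^sup>+\<omega>. H (Y \<omega>, Z \<omega>') \<partial>M \<partial>M)"
    by (subst nn_integral_distr[OF Z])
      (auto intro!: nn_integral_cong simp: nn_integral_distr measurable_space[OF Z])
  also have "\<dots> = (\<integral>\<^sup>+\<omega>'. \<integral>\<^sup>+\<omega>. h (N (X s \<omega>') \<omega>) (N (X t \<omega>') \<omega>) \<partial>M \<partial>M)"
  proof (rule nn_integral_cong_AE)
    show "AE \<omega>' in M. (\<integral>\<^sup>+\<omega>. H (Y \<omega>, Z \<omega>') \<partial>M) =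
       (\<integral>\<^sup>+\<omega>. h (N (X s \<omega>') \<omega>) (N (X t \<omega>') \<omega>) \<partial>M)"
      using nn
    proof eventually_elim
      case (elim \<omega>')
      show ?case
      proof (rule nn_integral_cong_AE)
        show "AE \<omega> in M. H (Y \<omega>, Z \<omega>') = h (N (X s \<omega>') \<omega>) (N (X t \<omega>') \<omega>)"
          using rc
          by eventually_elim
            (use st elim in \<open>simp add: H_def Y_def Z_def right_value_restrict right_value_eq\<close>)
      qed
    qed
  qed
  finally show ?thesis .
qed

lemma (in prob_space) levy_process_rv:
  "levy_process X \<Longrightarrow> 0 \<le> t \<Longrightarrow> random_variable borel (X t)"
  by (simp add: levy_process_def stochastic_process_def)

text \<open>The independent copy of the increment is realised by a second integration over
  \<open>M\<close>. This serves both the Poisson product moment and the ordered occupation integral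
  of a subordinator.\<close>

lemma (in prob_space) levy_process_nn_integral_increment:
  fixes f :: "real \<Rightarrow> real \<Rightarrow> ennreal"
  assumes X: "levy_process X" and xh: "0 \<le> x" "0 \<le> h"
    and f[measurable]: "(\<lambda>(a, b). f a b) \<in> borel_measurable (borel \<Otimes>\<^sub>M borel)"
  shows "(\<integral>\<^sup>+\<omega>. f (X x \<omega>) (X (x + h) \<omega> - X x \<omega>) \<partial>M) =
    (\<integral>\<^sup>+\<omega>'. \<integral>\<^sup>+\<omega>. f (X x \<omega>') (X h \<omega>) \<partial>M \<partial>M)"
proof -
  note [measurable] = levy_process_rv[OF X]
  \<comment> \<open>The times 0, \<open>x\<close>, \<open>x + h\<close> produce the two increments;
    the sequence is constant afterwards so as to be monotone on all naturals. The first increment is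
    \<open>X x - X 0\<close>, almost surely \<open>X x\<close>.\<close>
  define \<tau> where "\<tau> = (\<lambda>i::nat. if i = 0 then 0 else if i = 1 then x else x + h)"
  have "0 \<le> \<tau> 0 \<and> incseq \<tau>"
    using xh by (auto simp: \<tau>_def incseq_def)
  then have "indep_vars (\<lambda>_. borel) (\<lambda>i \<omega>. X (\<tau> (Suc i)) \<omega> - X (\<tau> i) \<omega>) {..<2}"
    using X by (auto simp: levy_process_def)
  from indep_var_restrict[OF this, of "{0}" "{1}"]
  have "indep_var (PiM {0} (\<lambda>_. borel)) (\<lambda>\<omega>. restrict (\<lambda>i. X (\<tau> (Suc i)) \<omega> - X (\<tau> i) \<omega>) {0})
     (PiM {1} (\<lambda>_. borel)) (\<lambda>\<omega>. restrict (\<lambda>i. X (\<tau> (Suc i)) \<omega> - X (\<tau> i) \<omega>) {1})"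
    by auto
  from indep_var_compose[OF this, of "\<lambda>w. w 0" borel "\<lambda>w. w 1" borel]
  have iv: "indep_var borel (\<lambda>\<omega>. X x \<omega> - X 0 \<omega>) borel (\<lambda>\<omega>. X (x + h) \<omega> - X x \<omega>)"
    by (simp add: comp_def \<tau>_def measurable_component_singleton)
  have eq: "distr M borel (\<lambda>\<omega>. X (x + h) \<omega> - X x \<omega>) = distr M borel (X h)"
    "distr M borel (\<lambda>\<omega>. X x \<omega> - X 0 \<omega>) = distr M borel (X x)"
    using X xh by (auto simp: levy_process_def dest: spec[of _ 0])
  have j: "distr M borel (X x) \<Otimes>\<^sub>M distr M borel (X h) =
    distr M (borel \<Otimes>\<^sub>M borel) (\<lambda>\<omega>. (X x \<omega> - X 0 \<omega>, X (x + h) \<omega> - X x \<omega>))"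
    using iv eq by (simp add: indep_var_distribution_eq)
  interpret H: prob_space "distr M borel (X h)"
    using xh by (intro prob_space_distr) auto
  have "(\<integral>\<^sup>+\<omega>. f (X x \<omega>) (X (x + h) \<omega> - X x \<omega>) \<partial>M) =
     (\<integral>\<^sup>+\<omega>. f (X x \<omega> - X 0 \<omega>) (X (x + h) \<omega> - X x \<omega>) \<partial>M)"
    using X by (intro nn_integral_cong_AE) (auto simp: levy_process_def elim!: eventually_mono)
  also have "\<dots> = (\<integral>\<^sup>+p. f (fst p) (snd p) \<partial>(distr M borel (X x) \<Otimes>\<^sub>M distr M borel (X h)))"
    unfolding j using xh by (subst nn_integral_distr) (auto simp: case_prod_beta)
  also have "\<dots> = (\<integral>\<^sup>+a. \<integral>\<^sup>+b. f a b \<partial>distr M borel (X h) \<partial>distr M borel (X x))"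
    by (subst H.nn_integral_fst[symmetric]) (auto simp: case_prod_beta)
  also have "\<dots> = (\<integral>\<^sup>+\<omega>'. \<integral>\<^sup>+\<omega>. f (X x \<omega>') (X h \<omega>) \<partial>M \<partial>M)"
    using xh by (subst nn_integral_distr) (auto intro!: nn_integral_cong simp: nn_integral_distr)
  finally show ?thesis .
qed

section \<open>Moments of the Poisson process\<close>

lemma poisson_pmf_nn_moments:
  assumes "0 < r"
  shows "(\<integral>\<^sup>+n. ennreal (real n) \<partial>poisson_pmf r) = ennreal r"
    and "(\<integral>\<^sup>+n. ennreal ((real n)\<^sup>2) \<partial>poisson_pmf r) = ennreal (r + r\<^sup>2)"
proof -
  have s0: "(\<lambda>n. r ^ n / fact n) sums exp r"
    using exp_converges[of r] by (simp add: divide_inverse mult.commute)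
  have "(\<lambda>n. real (Suc n) * (r ^ Suc n / fact (Suc n))) sums (r * exp r)"
    using sums_mult[OF s0, of r] by (simp add: field_simps del: of_nat_Suc)
  then have s1: "(\<lambda>n. real n * (r ^ n / fact n)) sums (r * exp r)"
    using sums_Suc[of "\<lambda>n. real n * (r ^ n / fact n)"] by simp
  \<comment> \<open>One factor \<open>Suc n\<close> cancels against the factorial, and the other
    splits as \<open>n + 1\<close>, giving the series of the mean plus the exponential
    series.\<close>
  have "(\<lambda>n. (real (Suc n))\<^sup>2 * (r ^ Suc n / fact (Suc n))) =
     (\<lambda>n. r * (real n * (r ^ n / fact n) + r ^ n / fact n))"
    by (intro ext) (simp add: divide_simps power2_eq_square, simp add: algebra_simps)
  then have "(\<lambda>n. (real (Suc n))\<^sup>2 * (r ^ Suc n / fact (Suc n))) sums (r * (r * exp r + exp r))"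
    using sums_mult[OF sums_add[OF s1 s0], of r] by simp
  then have s2: "(\<lambda>n. (real n)\<^sup>2 * (r ^ n / fact n)) sums (r * (r * exp r + exp r))"
    using sums_Suc[of "\<lambda>n. (real n)\<^sup>2 * (r ^ n / fact n)"] by simp
  \<comment> \<open>The sum is stated as \<open>c * exp r\<close> so that the Poisson weight
    \<open>exp (- r)\<close> cancels and leaves the moment \<open>c\<close>.\<close>
  have *: "(\<integral>\<^sup>+n. ennreal (g n) \<partial>poisson_pmf r) = ennreal c"
    if "(\<lambda>n. g n * (r ^ n / fact n)) sums (c * exp r)" "\<And>n. 0 \<le> g n" for g c
  proof -
    have "(\<integral>\<^sup>+n. ennreal (g n) \<partial>poisson_pmf r) =
       (\<Sum>n. ennreal (r ^ n / fact n * exp (- r)) * ennreal (g n))"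
      using assms by (simp add: nn_integral_measure_pmf nn_integral_count_space_nat)
    also have "\<dots> = (\<Sum>n. ennreal (g n * (r ^ n / fact n) * exp (- r)))"
      using assms that(2) by (simp add: ennreal_mult'[symmetric] mult_ac)
    also have "\<dots> = ennreal (c * exp r * exp (- r))"
      using assms that(2) by (intro suminf_ennreal_eq sums_mult2 that(1)) auto
    finally show ?thesis by (simp add: mult.assoc exp_add[symmetric])
  qed
  show "(\<integral>\<^sup>+n. ennreal (real n) \<partial>poisson_pmf r) = ennreal r"
    using s1 by (intro *) auto
  show "(\<integral>\<^sup>+n. ennreal ((real n)\<^sup>2) \<partial>poisson_pmf r) = ennreal (r + r\<^sup>2)"
    using s2 by (intro *) (auto simp: algebra_simps power2_eq_square)
qed

context prob_space
begin

context
  fixes N :: "real \<Rightarrow> 'a \<Rightarrow> real" and lam :: real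
  assumes lam: "0 < lam" and N: "poisson_process lam N"
begin

lemma poisson_process_levy: "levy_process N"
  using N by (simp add: poisson_process_def)

lemma poisson_process_rv: "0 \<le> t \<Longrightarrow> random_variable borel (N t)"
  by (rule levy_process_rv[OF poisson_process_levy])

lemma poisson_process_zero: "AE \<omega> in M. N 0 \<omega> = 0"
  using poisson_process_levy by (simp add: levy_process_def)

lemma poisson_process_right_continuous:
  "AE \<omega> in M. \<forall>t\<ge>0. continuous (at_right t) (\<lambda>r. N r \<omega>)"
  using poisson_process_levy by (auto simp: levy_process_def elim!: eventually_mono)

lemma poisson_process_nonneg_at:
  assumes "0 \<le> t"
  shows "AE \<omega> in M. 0 \<le> N t \<omega>"
proof (cases "t = 0")
  case True
  with poisson_process_zero show ?thesis by (auto elim!: eventually_mono)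
next
  case False
  have d: "distr M borel (N t) = distr (poisson_pmf (lam * t)) borel real"
    using N assms False by (simp add: poisson_process_def)
  have "AE x in distr M borel (N t). 0 \<le> x"
    unfolding d by (simp add: AE_distr_iff)
  then show ?thesis
    using poisson_process_rv[OF assms] by (simp add: AE_distr_iff)
qed

text \<open>The one-dimensional laws give the sign only at fixed times, each with its own null set.
  Rational times share a null set, and a negative value elsewhere would persist by right-continuity
  up to a rational time.\<close>

lemma poisson_process_nonneg: "AE \<omega> in M. \<forall>t\<ge>0. 0 \<le> N t \<omega>"
proof -
  have "AE \<omega> in M. \<forall>r\<in>\<rat> \<inter> {0..}. 0 \<le> N r \<omega>"
    using poisson_process_nonneg_at by (subst AE_ball_countable) (auto intro: countable_rat)
  with poisson_process_right_continuous show ?thesis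
  proof eventually_elim
    case (elim \<omega>)
    show ?case
    proof (intro allI impI, rule ccontr)
      fix t :: real assume t: "0 \<le> t" "\<not> 0 \<le> N t \<omega>"
      have "((\<lambda>r. N r \<omega>) \<longlongrightarrow> N t \<omega>) (at_right t)"
        using elim(1) t(1) by (auto simp: continuous_within)
      then have "eventually (\<lambda>r. N r \<omega> < 0) (at_right t)"
        using t(2) by (intro order_tendstoD(2)[of _ "N t \<omega>"]) auto
      then obtain u where u: "t < u" "\<And>r. t < r \<Longrightarrow> r < u \<Longrightarrow> N r \<omega> < 0"
        by (auto simp: eventually_at_right_field)
      obtain r where "r \<in> \<rat>" "t < r" "r < u"
        using Rats_dense_in_real[OF u(1)] by auto
      with elim(2) u(2)[of r] t(1) show False
        by (auto dest!: bspec[of _ _ r])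
    qed
  qed
qed

lemma poisson_process_moments:
  assumes "0 \<le> t"
  shows "(\<integral>\<^sup>+\<omega>. ennreal (N t \<omega>) \<partial>M) = ennreal (lam * t)"
    and "(\<integral>\<^sup>+\<omega>. ennreal ((N t \<omega>)\<^sup>2) \<partial>M) = ennreal (lam * t + (lam * t)\<^sup>2)"
proof -
  \<comment> \<open>The conditions at 0 serve \<open>t = 0\<close>, where no law is prescribed and
    only \<open>N 0 = 0\<close> almost surely is known.\<close>
  have *: "(\<integral>\<^sup>+\<omega>. ennreal (g (N t \<omega>)) \<partial>M) = ennreal (c (lam * t))"
    if g[measurable]: "g \<in> borel_measurable borel" and "g 0 = 0" "c 0 = 0"
      and *: "\<And>r. 0 < r \<Longrightarrow> (\<integral>\<^sup>+n. ennreal (g (real n)) \<partial>poisson_pmf r) = ennreal (c r)"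
    for g c
  proof (cases "t = 0")
    case True
    have "(\<integral>\<^sup>+\<omega>. ennreal (g (N t \<omega>)) \<partial>M) = (\<integral>\<^sup>+\<omega>. 0 \<partial>M)"
      using poisson_process_zero True that(2)
      by (intro nn_integral_cong_AE) (auto elim!: eventually_mono)
    with True that show ?thesis by simp
  next
    case False
    note [measurable] = poisson_process_rv[OF assms]
    have "(\<integral>\<^sup>+\<omega>. ennreal (g (N t \<omega>)) \<partial>M) = (\<integral>\<^sup>+x. ennreal (g x) \<partial>distr M borel (N t))"
      by (simp add: nn_integral_distr)
    also have "\<dots> = (\<integral>\<^sup>+n. ennreal (g (real n)) \<partial>poisson_pmf (lam * t))"
      using N False assms by (simp add: poisson_process_def nn_integral_distr)
    finally show ?thesis using * False lam assms by simp
  qed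
  show "(\<integral>\<^sup>+\<omega>. ennreal (N t \<omega>) \<partial>M) = ennreal (lam * t)"
    using *[of "\<lambda>x. x" "\<lambda>x. x"] poisson_pmf_nn_moments(1) by simp
  show "(\<integral>\<^sup>+\<omega>. ennreal ((N t \<omega>)\<^sup>2) \<partial>M) = ennreal (lam * t + (lam * t)\<^sup>2)"
    using *[of "\<lambda>x. x\<^sup>2" "\<lambda>r. r + r\<^sup>2"] poisson_pmf_nn_moments(2) by simp
qed

text \<open>Writing \<open>N y\<close> as \<open>N x\<close> plus an independent increment leaves
  the second moment of \<open>N x\<close> and the product of two means. The quadratic terms combine
  to \<open>lam\<^sup>2 * (x * y)\<close>.\<close>

lemma poisson_process_product_moment:
  assumes "0 \<le> x" "x \<le> y"
  shows "(\<integral>\<^sup>+\<omega>. ennreal (N x \<omega> * N y \<omega>) \<partial>M) = ennreal (lam * x + lam\<^sup>2 * (x * y))"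
proof -
  have x: "0 \<le> x" and h: "0 \<le> y - x" using assms by auto
  note [measurable] = poisson_process_rv[OF x] poisson_process_rv[OF h]
  have "(\<integral>\<^sup>+\<omega>. ennreal (N x \<omega> * N y \<omega>) \<partial>M) =
      (\<integral>\<^sup>+\<omega>. ennreal (N x \<omega> * (N x \<omega> + (N (x + (y - x)) \<omega> - N x \<omega>))) \<partial>M)"
    by simp
  also have "\<dots> = (\<integral>\<^sup>+\<omega>'. \<integral>\<^sup>+\<omega>. ennreal (N x \<omega>' * (N x \<omega>' + N (y - x) \<omega>)) \<partial>M \<partial>M)"
    using h x by (intro levy_process_nn_integral_increment poisson_process_levy) auto
  also have "\<dots> = (\<integral>\<^sup>+\<omega>'. ennreal ((N x \<omega>')\<^sup>2) + ennreal (lam * (y - x)) * ennreal (N x \<omega>') \<partial>M)"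
  proof (rule nn_integral_cong_AE, use poisson_process_nonneg_at[OF x] in eventually_elim)
    case (elim \<omega>')
    have "(\<integral>\<^sup>+\<omega>. ennreal (N x \<omega>' * (N x \<omega>' + N (y - x) \<omega>)) \<partial>M) =
       (\<integral>\<^sup>+\<omega>. ennreal ((N x \<omega>')\<^sup>2) + ennreal (N x \<omega>') * ennreal (N (y - x) \<omega>) \<partial>M)"
      using poisson_process_nonneg_at[OF h] elim
      by (intro nn_integral_cong_AE)
        (auto simp: ennreal_mult'[symmetric] ennreal_plus[symmetric] distrib_left power2_eq_square
              simp del: ennreal_plus elim!: eventually_mono)
    then show ?case
      by (simp add: nn_integral_add nn_integral_cmult poisson_process_moments[OF h] emeasure_space_1 mult.commute)
  qed
  also have "\<dots> = ennreal (lam * x + (lam * x)\<^sup>2) + ennreal (lam * (y - x)) * ennreal (lam * x)"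
    by (simp add: nn_integral_add nn_integral_cmult poisson_process_moments[OF x])
  also have "\<dots> = ennreal (lam * x + lam\<^sup>2 * (x * y))"
  proof -
    have "lam * x + (lam * x)\<^sup>2 + lam * (y - x) * (lam * x) = lam * x + lam\<^sup>2 * (x * y)"
      by (simp add: power2_eq_square algebra_simps)
    then show ?thesis
      using lam x h by (simp add: ennreal_mult'[symmetric] ennreal_plus[symmetric] del: ennreal_plus)
  qed
  finally show ?thesis .
qed

end

end

section \<open>The potential measure of the stable subordinator\<close>

lemma Gamma_real_one_plus: "0 < x \<Longrightarrow> Gamma (1 + x) = x * Gamma (x :: real)"
  by (metis Gamma_plus1 add.commute nonpos_Ints_nonpos not_le)

section \<open>Incomplete beta integrals\<close>

lemma incomplete_beta_nonneg: "0 \<le> incomplete_beta a b x"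
  unfolding incomplete_beta_def set_lebesgue_integral_def by (intro integral_nonneg_AE) auto

lemma set_integrable_incomplete_beta:
  fixes a b x :: real
  assumes "0 < a" "0 < b" "x \<le> 1"
  shows "set_integrable lborel {0..x} (\<lambda>u. u powr (a - 1) * (1 - u) powr (b - 1))"
  by (rule set_integrable_subset[OF integrable_Beta[of a b]]) (use assms in auto)

lemma incomplete_beta_le:
  fixes a b x :: real
  assumes "0 < a" "0 < b" "x \<le> 1"
  shows "incomplete_beta a b x \<le> incomplete_beta a b 1"
  unfolding incomplete_beta_def set_lebesgue_integral_def
  using assms set_integrable_incomplete_beta[OF assms(1,2)]
  by (intro integral_mono) (auto simp: set_integrable_def split: split_indicator)

lemma borel_measurable_incomplete_beta[measurable]: "incomplete_beta a b \<in> borel_measurable borel"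
proof -
  have "(\<lambda>(x, u). indicator {0..x} u *\<^sub>R (u powr (a - 1) * (1 - u) powr (b - 1)) :: real)
      = (\<lambda>(x, u). if 0 \<le> u \<and> u \<le> x then u powr (a - 1) * (1 - u) powr (b - 1) else 0)"
    by (auto simp: fun_eq_iff)
  also have "\<dots> \<in> borel_measurable (borel \<Otimes>\<^sub>M lborel)"
    by measurable
  finally show ?thesis
    unfolding incomplete_beta_def[abs_def] set_lebesgue_integral_def
    by (rule lborel.borel_measurable_lebesgue_integral)
qed

lemma incomplete_beta_1_2:
  assumes "0 \<le> x" "x \<le> 1"
  shows "incomplete_beta 1 2 x = x - x\<^sup>2 / 2"
proof -
  \<comment> \<open>The integrands differ at \<open>u = 0\<close>, where \<open>0 powr 0\<close> is
    0; this is a null set.\<close>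
  have "incomplete_beta 1 2 x = (LBINT u:{0..x}. 1 - u)"
    unfolding incomplete_beta_def using assms
    by (intro set_lebesgue_integral_cong_AE)
       (use AE_lborel_singleton[of 0] in \<open>auto elim!: eventually_mono\<close>)
  also have "\<dots> = (x - x\<^sup>2 / 2) - (0 - 0\<^sup>2 / 2)"
    unfolding set_lebesgue_integral_def
    by (subst integral_FTC_Icc_real[OF assms(1), where F="\<lambda>u. u - u\<^sup>2 / 2", symmetric])
       (auto intro!: derivative_eq_intros continuous_intros simp: mult.commute)
  finally show ?thesis by simp
qed

text \<open>Substituting \<open>y * u\<close> for \<open>u\<close> extracts one power of
  \<open>y\<close> from the differential and \<open>a - 1\<close> and \<open>b - 1\<close> powers
  from the factors.\<close>

lemma nn_integral_incomplete_beta: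
  assumes ab: "0 < a" "0 < b" and xy: "0 \<le> x" "x \<le> y"
  shows "(\<integral>\<^sup>+u. ennreal (u powr (a - 1) * (y - u) powr (b - 1)) * indicator {0..x} u \<partial>lborel) =
    ennreal (y powr (a + b - 1) * incomplete_beta a b (x / y))"
proof (cases "y = 0")
  \<comment> \<open>Both sides vanish, since \<open>0 powr c\<close> is 0 for every \<open>c\<close>
    and the range of integration is the point 0.\<close>
  case True
  then have "(\<integral>\<^sup>+u. ennreal (u powr (a - 1) * (y - u) powr (b - 1)) * indicator {0..x} u \<partial>lborel) =
     (\<integral>\<^sup>+u. 0 \<partial>(lborel :: real measure))"
    using xy by (intro nn_integral_cong) (auto split: split_indicator)
  with True show ?thesis by simp
next
  case False
  then have y: "0 < y" using xy by simp
  have "(\<integral>\<^sup>+u. ennreal (u powr (a - 1) * (y - u) powr (b - 1)) * indicator {0..x} u \<partial>lborel) =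
    ennreal y * (\<integral>\<^sup>+u. ennreal ((y * u) powr (a - 1) * (y - y * u) powr (b - 1)) * indicator {0..x} (y * u) \<partial>lborel)"
    using y by (subst nn_integral_real_affine[where c=y and t=0]) auto
  also have "\<dots> = (\<integral>\<^sup>+u. ennreal (y powr (a + b - 1)) *
      ennreal (indicator {0..x / y} u *\<^sub>R (u powr (a - 1) * (1 - u) powr (b - 1))) \<partial>lborel)"
  proof (subst nn_integral_cmult[symmetric])
    have "ennreal y * (ennreal ((y * u) powr (a - 1) * (y - y * u) powr (b - 1)) * indicator {0..x} (y * u)) =
      ennreal (y powr (a + b - 1)) *
      ennreal (indicator {0..x / y} u *\<^sub>R (u powr (a - 1) * (1 - u) powr (b - 1)))" for u
    proof (cases "u \<in> {0..x / y}")
      case True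
      then have u: "0 \<le> u" "y * u \<le> x" using y by (auto simp: pos_le_divide_eq mult.commute)
      have "u \<le> x / y" using True by simp
      also have "\<dots> \<le> 1" using xy y by simp
      finally have "u \<le> 1" .
      have "y - y * u = y * (1 - u)" by (simp add: algebra_simps)
      then have "y * ((y * u) powr (a - 1) * (y - y * u) powr (b - 1)) =
        (y powr 1 * y powr (a - 1) * y powr (b - 1)) * (u powr (a - 1) * (1 - u) powr (b - 1))"
        using y u \<open>u \<le> 1\<close> by (simp add: powr_mult)
      also have "y powr 1 * y powr (a - 1) * y powr (b - 1) = y powr (a + b - 1)"
        by (simp only: powr_add[symmetric]) (simp add: algebra_simps)
      finally show ?thesis
        using True u y by (simp add: ennreal_mult'[symmetric])
    next
      case False
      then have "y * u \<notin> {0..x}" using y by (auto simp: pos_le_divide_eq mult.commute zero_le_mult_iff)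
      with False show ?thesis by simp
    qed
    then show "(\<integral>\<^sup>+u. ennreal y * (ennreal ((y * u) powr (a - 1) * (y - y * u) powr (b - 1)) * indicator {0..x} (y * u)) \<partial>lborel)
      = (\<integral>\<^sup>+u. ennreal (y powr (a + b - 1)) *
      ennreal (indicator {0..x / y} u *\<^sub>R (u powr (a - 1) * (1 - u) powr (b - 1))) \<partial>lborel)"
      by simp
  qed auto
  also have "\<dots> = ennreal (y powr (a + b - 1)) * ennreal (incomplete_beta a b (x / y))"
    using set_integrable_incomplete_beta[OF ab, of "x / y"] xy y
    unfolding incomplete_beta_def set_lebesgue_integral_def set_integrable_def
    by (simp add: nn_integral_cmult nn_integral_eq_integral)
  finally show ?thesis
    by (simp only: ennreal_mult''[OF incomplete_beta_nonneg])
qed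

lemma nn_integral_powr_from_0:
  assumes "-1 < a" "0 \<le> c"
  shows "(\<integral>\<^sup>+u. ennreal (u powr a) * indicator {0..c} u \<partial>lborel) = ennreal (c powr (a + 1) / (a + 1))"
  by (rule nn_integral_has_integral_lebesgue'[OF _ has_integral_powr_from_0[OF assms]]) simp

lemma nn_integral_exp_from_0:
  assumes "0 < c"
  shows "(\<integral>\<^sup>+u. ennreal (exp (- c * u)) * indicator {0..} u \<partial>lborel) = ennreal (1 / c)"
  using nn_integral_has_integral_lebesgue'[OF _ has_integral_exp_minus_to_infinity[OF assms, of 0]]
  by simp

text \<open>The kernel of the Riemann-Liouville fractional integral of order \<open>\<beta>\<close>.
  For \<open>0 < \<beta>\<close> its total mass is infinite.\<close>

definition gamma_kernel :: "real \<Rightarrow> real measure" where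
  "gamma_kernel \<beta> = density lborel (\<lambda>z. ennreal (z powr (\<beta> - 1) / Gamma \<beta>) * indicator {0..} z)"

lemma sets_gamma_kernel[measurable_cong]: "sets (gamma_kernel \<beta>) = sets borel"
  by (simp add: gamma_kernel_def)

lemma nn_integral_gamma_kernel:
  assumes [measurable]: "g \<in> borel_measurable borel"
  shows "(\<integral>\<^sup>+z. g z \<partial>gamma_kernel \<beta>) =
    (\<integral>\<^sup>+z. ennreal (z powr (\<beta> - 1) / Gamma \<beta>) * indicator {0..} z * g z \<partial>lborel)"
  unfolding gamma_kernel_def by (simp add: nn_integral_density)

lemma AE_gamma_kernel_nonneg: "AE z in gamma_kernel \<beta>. 0 \<le> z"
  unfolding gamma_kernel_def by (subst AE_density) (auto split: split_indicator intro!: AE_I2)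

text \<open>Euler's integral for \<open>Gamma \<beta>\<close> after replacing \<open>t\<close> by
  \<open>s * t\<close>.\<close>

lemma gamma_kernel_laplace:
  assumes \<beta>: "0 < \<beta>" and s: "0 < s"
  shows "(\<integral>\<^sup>+z. ennreal (exp (- s * z)) \<partial>gamma_kernel \<beta>) = ennreal (1 / s powr \<beta>)"
proof -
  have G: "0 < Gamma \<beta>" using \<beta> by (rule Gamma_real_pos)
  have "ennreal (Gamma \<beta>) = (\<integral>\<^sup>+t. ennreal (indicator {0..} t * t powr (\<beta> - 1) / exp t) \<partial>lborel)"
    by (rule Gamma_conv_nn_integral_real[OF \<beta>])
  also have "\<dots> = ennreal s * (\<integral>\<^sup>+t. ennreal (indicator {0..} (s * t) * (s * t) powr (\<beta> - 1) / exp (s * t)) \<partial>lborel)"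
    using s by (subst nn_integral_real_affine[where c=s and t=0]) auto
  also have "\<dots> = (\<integral>\<^sup>+t. ennreal (s powr \<beta> * Gamma \<beta>) *
     (ennreal (t powr (\<beta> - 1) / Gamma \<beta>) * indicator {0..} t * ennreal (exp (- s * t))) \<partial>lborel)"
  proof (subst nn_integral_cmult[symmetric])
    have "ennreal s * ennreal (indicator {0..} (s * t) * (s * t) powr (\<beta> - 1) / exp (s * t)) =
      ennreal (s powr \<beta> * Gamma \<beta>) *
     (ennreal (t powr (\<beta> - 1) / Gamma \<beta>) * indicator {0..} t * ennreal (exp (- s * t)))" for t
    proof (cases "0 \<le> t")
      case True
      have "s * ((s * t) powr (\<beta> - 1) / exp (s * t)) = (s powr 1 * s powr (\<beta> - 1)) * t powr (\<beta> - 1) * exp (- (s * t))"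
        using s True by (simp add: powr_mult exp_minus field_simps)
      also have "s powr 1 * s powr (\<beta> - 1) = s powr \<beta>"
        by (simp only: powr_add[symmetric]) simp
      finally show ?thesis
        using True s G by (simp add: ennreal_mult'[symmetric])
    qed (use s in \<open>auto simp: zero_le_mult_iff\<close>)
    then show "(\<integral>\<^sup>+t. ennreal s * ennreal (indicator {0..} (s * t) * (s * t) powr (\<beta> - 1) / exp (s * t)) \<partial>lborel) =
     (\<integral>\<^sup>+t. ennreal (s powr \<beta> * Gamma \<beta>) *
     (ennreal (t powr (\<beta> - 1) / Gamma \<beta>) * indicator {0..} t * ennreal (exp (- s * t))) \<partial>lborel)"
      by simp
  qed auto
  also have "\<dots> = ennreal (s powr \<beta> * Gamma \<beta>) * (\<integral>\<^sup>+z. ennreal (exp (- s * z)) \<partial>gamma_kernel \<beta>)"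
    by (subst nn_integral_cmult) (auto simp: nn_integral_gamma_kernel)
  finally have *: "ennreal (Gamma \<beta>) = ennreal (s powr \<beta> * Gamma \<beta>) * (\<integral>\<^sup>+z. ennreal (exp (- s * z)) \<partial>gamma_kernel \<beta>)" .
  have "ennreal (1 / (s powr \<beta> * Gamma \<beta>)) * ennreal (Gamma \<beta>) = ennreal (1 / s powr \<beta>)"
    using G s by (simp add: ennreal_mult'[symmetric])
  moreover have "ennreal (1 / (s powr \<beta> * Gamma \<beta>)) * (ennreal (s powr \<beta> * Gamma \<beta>) * X) = X" for X
    using G s by (simp add: mult.assoc[symmetric] ennreal_mult'[symmetric])
  ultimately show ?thesis
    using * by metis
qed

lemma emeasure_gamma_kernel:
  assumes \<beta>: "0 < \<beta>" and z: "0 \<le> z"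
  shows "emeasure (gamma_kernel \<beta>) {..z} = ennreal (z powr \<beta> / Gamma (1 + \<beta>))"
proof -
  have G: "0 < Gamma \<beta>" using \<beta> by (rule Gamma_real_pos)
  note G1 = Gamma_real_one_plus[OF \<beta>]
  have "emeasure (gamma_kernel \<beta>) {..z} = (\<integral>\<^sup>+u. indicator {..z} u \<partial>gamma_kernel \<beta>)"
    by simp
  also have "\<dots> = (\<integral>\<^sup>+u. ennreal (1 / Gamma \<beta>) * (ennreal (u powr (\<beta> - 1)) * indicator {0..z} u) \<partial>lborel)"
    by (subst nn_integral_gamma_kernel)
       (use G in \<open>auto intro!: nn_integral_cong split: split_indicator simp: ennreal_mult'[symmetric]\<close>)
  also have "\<dots> = ennreal (1 / Gamma \<beta>) * ennreal (z powr \<beta> / \<beta>)"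
    using nn_integral_powr_from_0[of "\<beta> - 1" z] \<beta> z by (simp add: nn_integral_cmult)
  finally show ?thesis
    using G \<beta> by (simp add: G1 ennreal_mult'[symmetric] mult.commute)
qed

text \<open>The inner integral is the mass of \<open>{..y - a}\<close>, proportional to
  \<open>(y - a) powr \<beta>\<close>, which makes \<open>1 + \<beta>\<close> the second beta
  parameter. The numerator \<open>\<beta>\<close> appears when \<open>Gamma \<beta>\<close> is
  rewritten as \<open>Gamma (1 + \<beta>) / \<beta>\<close>.\<close>

lemma gamma_kernel_convolution:
  assumes \<beta>: "0 < \<beta>" and xy: "0 \<le> x" "x \<le> y"
  shows "(\<integral>\<^sup>+a. \<integral>\<^sup>+b. indicator {..x} a * indicator {..y} (a + b) \<partial>gamma_kernel \<beta> \<partial>gamma_kernel \<beta>) =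
    ennreal (\<beta> / (Gamma (1 + \<beta>))\<^sup>2 * (y powr (2 * \<beta>) * incomplete_beta \<beta> (1 + \<beta>) (x / y)))"
proof -
  have G: "0 < Gamma \<beta>" using \<beta> by (rule Gamma_real_pos)
  note G1 = Gamma_real_one_plus[OF \<beta>]
  have "(\<integral>\<^sup>+a. \<integral>\<^sup>+b. indicator {..x} a * indicator {..y} (a + b) \<partial>gamma_kernel \<beta> \<partial>gamma_kernel \<beta>) =
    (\<integral>\<^sup>+a. indicator {..x} a * emeasure (gamma_kernel \<beta>) {..y - a} \<partial>gamma_kernel \<beta>)"
  proof (rule nn_integral_cong)
    fix a
    have "(\<integral>\<^sup>+b. indicator {..x} a * indicator {..y} (a + b) \<partial>gamma_kernel \<beta>) =
      (\<integral>\<^sup>+b. indicator {..x} a * indicator {..y - a} b \<partial>gamma_kernel \<beta>)"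
      by (intro nn_integral_cong) (auto split: split_indicator)
    then show "(\<integral>\<^sup>+b. indicator {..x} a * indicator {..y} (a + b) \<partial>gamma_kernel \<beta>) =
      indicator {..x} a * emeasure (gamma_kernel \<beta>) {..y - a}"
      by (simp add: nn_integral_cmult)
  qed
  also have "\<dots> = (\<integral>\<^sup>+a. indicator {..x} a * ennreal ((y - a) powr \<beta> / Gamma (1 + \<beta>)) \<partial>gamma_kernel \<beta>)"
    using xy emeasure_gamma_kernel[OF \<beta>] by (intro nn_integral_cong) (auto split: split_indicator)
  also have "\<dots> = (\<integral>\<^sup>+a. ennreal (1 / (Gamma \<beta> * Gamma (1 + \<beta>))) *
     (ennreal (a powr (\<beta> - 1) * (y - a) powr ((1 + \<beta>) - 1)) * indicator {0..x} a) \<partial>lborel)"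
    by (subst nn_integral_gamma_kernel)
       (use G \<beta> G1 in \<open>auto intro!: nn_integral_cong split: split_indicator simp: ennreal_mult'[symmetric]\<close>)
  also have "\<dots> = ennreal (1 / (Gamma \<beta> * Gamma (1 + \<beta>))) *
     ennreal (y powr (2 * \<beta>) * incomplete_beta \<beta> (1 + \<beta>) (x / y))"
    using nn_integral_incomplete_beta[OF \<beta> _ xy, of "1 + \<beta>"] \<beta>
    by (subst nn_integral_cmult) (auto simp: algebra_simps)
  also have "\<dots> = ennreal (\<beta> / (Gamma (1 + \<beta>))\<^sup>2 * (y powr (2 * \<beta>) * incomplete_beta \<beta> (1 + \<beta>) (x / y)))"
    using G \<beta> by (simp add: G1 ennreal_mult'[symmetric] power2_eq_square)
  finally show ?thesis .
qed

section \<open>Occupation times and inverses of subordinators\<close>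

text \<open>Lebesgue measure for the time parameter. Formed as a density on the whole line, it keeps
  the sets of \<open>borel\<close>, so Borel functions need no restriction.\<close>

definition half_line :: "real measure" where
  "half_line = density lborel (indicator {0..})"

lemma sets_half_line[measurable_cong]: "sets half_line = sets borel"
  by (simp add: half_line_def)

lemma nn_integral_half_line:
  assumes [measurable]: "g \<in> borel_measurable borel"
  shows "(\<integral>\<^sup>+r. g r \<partial>half_line) = (\<integral>\<^sup>+r. g r * indicator {0..} r \<partial>lborel)"
  unfolding half_line_def by (simp add: nn_integral_density mult.commute)

lemma AE_half_line: "AE r in half_line. 0 \<le> r"
  unfolding half_line_def by (subst AE_density) (auto split: split_indicator intro!: AE_I2)

lemma AE_half_line_neq: "AE r in half_line. r \<noteq> c"
  unfolding half_line_def using AE_lborel_singleton[of c] by (subst AE_density) auto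

lemma emeasure_half_line: "emeasure half_line UNIV = \<infinity>"
proof -
  have "of_nat n \<le> emeasure half_line UNIV" for n
  proof -
    have "of_nat n = emeasure lborel {0..real n}"
      by (simp add: ennreal_of_nat_eq_real_of_nat)
    also have "\<dots> \<le> emeasure lborel {0::real..}"
      by (rule emeasure_mono) auto
    also have "\<dots> = emeasure half_line UNIV"
      by (simp add: half_line_def emeasure_density)
    finally show ?thesis .
  qed
  then have "(SUP n. of_nat n) \<le> emeasure half_line UNIV"
    by (rule SUP_least)
  then show ?thesis
    by (simp add: ennreal_SUP_of_nat_eq_top top_unique)
qed

lemma sigma_finite_half_line: "sigma_finite_measure half_line"
  unfolding half_line_def
  by (subst sigma_finite_measure.sigma_finite_iff_density_finite[OF sigma_finite_lborel]) (auto split: split_indicator intro!: AE_I2)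

interpretation half_line: sigma_finite_measure half_line
  by (rule sigma_finite_half_line)

lemma nn_integral_half_line_shift:
  assumes [measurable]: "g \<in> borel_measurable borel" and "0 \<le> r"
  shows "(\<integral>\<^sup>+u. (if r \<le> u then g u else 0) \<partial>half_line) = (\<integral>\<^sup>+h. g (r + h) \<partial>half_line)"
proof -
  have "(\<integral>\<^sup>+u. (if r \<le> u then g u else 0) \<partial>half_line) = (\<integral>\<^sup>+u. (if r \<le> u then g u else 0) * indicator {0..} u \<partial>lborel)"
    by (simp add: nn_integral_half_line)
  also have "\<dots> = (\<integral>\<^sup>+h. (if r \<le> r + h then g (r + h) else 0) * indicator {0..} (r + h) \<partial>lborel)"
    by (subst nn_integral_real_affine[where c=1 and t=r]) (auto intro!: nn_integral_cong)
  also have "\<dots> = (\<integral>\<^sup>+h. g (r + h) * indicator {0..} h \<partial>lborel)"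
    using \<open>0 \<le> r\<close> by (intro nn_integral_cong) (auto split: split_indicator)
  finally show ?thesis by (simp add: nn_integral_half_line)
qed

context prob_space
begin

context
  fixes D :: "real \<Rightarrow> 'a \<Rightarrow> real" and f :: "real \<Rightarrow> real"
  assumes D: "subordinator f D"
begin

lemma subordinator_levy: "levy_process D"
  using D by (simp add: subordinator_def)

lemma subordinator_rv: "0 \<le> t \<Longrightarrow> random_variable borel (D t)"
  by (rule levy_process_rv[OF subordinator_levy])

lemma subordinator_mono: "AE \<omega> in M. mono_on {0..} (\<lambda>t. D t \<omega>)"
  using D by (simp add: subordinator_def)

lemma subordinator_nonneg: "AE \<omega> in M. \<forall>t\<ge>0. 0 \<le> D t \<omega>"
proof -
  have "AE \<omega> in M. D 0 \<omega> = 0"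
    using subordinator_levy by (simp add: levy_process_def)
  with subordinator_mono show ?thesis
  proof eventually_elim
    case (elim \<omega>)
    then have "D 0 \<omega> \<le> D t \<omega>" if "0 \<le> t" for t
      using that by (intro mono_onD[of "{0..}" "\<lambda>t. D t \<omega>"]) auto
    with elim show ?case by simp
  qed
qed

text \<open>
  The paths of \<open>D\<close> are right-continuous only almost surely and \<open>M\<close> need not be complete, so
  Tonelli is applied to this jointly measurable version, almost surely equal to \<open>D\<close> at all times.
\<close>

definition regularized :: "real \<Rightarrow> 'a \<Rightarrow> real" where
  "regularized t \<omega> = right_value t (\<lambda>r. D r \<omega>)"

lemma measurable_regularized[measurable (raw)]:
  assumes "g \<in> borel_measurable K" "h \<in> measurable K M"
  shows "(\<lambda>k. regularized (g k) (h k)) \<in> borel_measurable K"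
proof -
  have "(\<lambda>\<omega>. \<lambda>r\<in>{0..}. D r \<omega>) \<in> measurable M (PiM {0..} (\<lambda>_. borel))"
    using subordinator_rv by (intro measurable_restrict) auto
  from measurable_compose[OF measurable_Pair[OF assms(1) measurable_compose[OF assms(2) this]]
      measurable_right_value]
  show ?thesis
    by (simp add: regularized_def right_value_restrict)
qed

lemma AE_regularized: "AE \<omega> in M. \<forall>t\<ge>0. regularized t \<omega> = D t \<omega>"
proof -
  have "AE \<omega> in M. \<forall>t\<ge>0. continuous (at_right t) (\<lambda>r. D r \<omega>)"
    using subordinator_levy by (simp add: levy_process_def)
  then show ?thesis
    by eventually_elim (simp add: regularized_def right_value_eq)
qed

lemma AE_regularized_at: "0 \<le> t \<Longrightarrow> AE \<omega> in M. regularized t \<omega> = D t \<omega>"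
  using AE_regularized by (auto elim!: eventually_mono)

definition potential_measure :: "real measure" where
  "potential_measure = distr (half_line \<Otimes>\<^sub>M M) borel (\<lambda>(t, \<omega>). regularized t \<omega>)"

lemma sets_potential_measure[measurable_cong]: "sets potential_measure = sets borel"
  by (simp add: potential_measure_def)

lemma nn_integral_potential_measure:
  assumes [measurable]: "g \<in> borel_measurable borel"
  shows "(\<integral>\<^sup>+z. g z \<partial>potential_measure) = (\<integral>\<^sup>+t. \<integral>\<^sup>+\<omega>. g (regularized t \<omega>) \<partial>M \<partial>half_line)"
proof -
  have "(\<integral>\<^sup>+z. g z \<partial>potential_measure) = (\<integral>\<^sup>+p. g (regularized (fst p) (snd p)) \<partial>(half_line \<Otimes>\<^sub>M M))"
    unfolding potential_measure_def by (subst nn_integral_distr) (auto simp: case_prod_beta)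
  also have "\<dots> = (\<integral>\<^sup>+t. \<integral>\<^sup>+\<omega>. g (regularized t \<omega>) \<partial>M \<partial>half_line)"
    by (subst nn_integral_fst[symmetric]) auto
  finally show ?thesis .
qed

lemma AE_potential_measure_nonneg: "AE z in potential_measure. 0 \<le> z"
proof -
  have "(\<integral>\<^sup>+z. indicator {..<0} z \<partial>potential_measure) =
      (\<integral>\<^sup>+t. \<integral>\<^sup>+\<omega>. indicator {..<0} (regularized t \<omega>) \<partial>M \<partial>half_line)"
    by (rule nn_integral_potential_measure) auto
  also have "\<dots> = (\<integral>\<^sup>+t. 0 \<partial>half_line)"
  proof (rule nn_integral_cong_AE, use AE_half_line in eventually_elim)
    case (elim t)
    have "(\<integral>\<^sup>+\<omega>. indicator {..<0} (regularized t \<omega>) \<partial>M) = (\<integral>\<^sup>+\<omega>. 0 \<partial>M)"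
    proof (rule nn_integral_cong_AE)
      show "AE \<omega> in M. indicator {..<0} (regularized t \<omega>) = (0 :: ennreal)"
        using AE_regularized subordinator_nonneg
      proof eventually_elim
        case (elim \<omega>)
        with \<open>0 \<le> t\<close> have "0 \<le> regularized t \<omega>" by simp
        then show ?case by simp
      qed
    qed
    then show ?case by simp
  qed
  finally have "emeasure potential_measure {..<0} = 0"
    by simp
  then show ?thesis
    by (intro AE_I[of _ _ "{..<0}"]) (auto simp: sets_potential_measure)
qed

text \<open>At a fixed time the transform is \<open>exp (- t * f s)\<close>, and its integral over
  all times is \<open>1 / f s\<close>.\<close>

lemma potential_measure_laplace:
  assumes s: "0 < s" and fs: "0 < f s"
  shows "(\<integral>\<^sup>+z. ennreal (exp (- s * z)) \<partial>potential_measure) = ennreal (1 / f s)"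
proof -
  have "(\<integral>\<^sup>+z. ennreal (exp (- s * z)) \<partial>potential_measure) =
     (\<integral>\<^sup>+t. \<integral>\<^sup>+\<omega>. ennreal (exp (- s * regularized t \<omega>)) \<partial>M \<partial>half_line)"
    by (rule nn_integral_potential_measure) auto
  also have "\<dots> = (\<integral>\<^sup>+t. ennreal (exp (- f s * t)) \<partial>half_line)"
  proof (rule nn_integral_cong_AE, use AE_half_line in eventually_elim)
    case (elim t)
    note [measurable] = subordinator_rv[OF elim]
    have nn: "AE \<omega> in M. 0 \<le> D t \<omega>"
      using subordinator_nonneg by eventually_elim (use elim in auto)
    have "(\<integral>\<^sup>+\<omega>. ennreal (exp (- s * regularized t \<omega>)) \<partial>M) = (\<integral>\<^sup>+\<omega>. ennreal (exp (- s * D t \<omega>)) \<partial>M)"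
      using AE_regularized_at[OF elim]
      by (intro nn_integral_cong_AE) (auto elim!: eventually_mono)
    also have "\<dots> = ennreal (expectation (\<lambda>\<omega>. exp (- s * D t \<omega>)))"
    proof (rule nn_integral_eq_integral)
      show "integrable M (\<lambda>\<omega>. exp (- s * D t \<omega>))"
      proof (rule integrable_const_bound[of _ 1])
        show "AE \<omega> in M. norm (exp (- s * D t \<omega>)) \<le> 1"
          using nn by eventually_elim (use s in auto)
      qed auto
    qed auto
    also have "\<dots> = ennreal (exp (- f s * t))"
      using D elim s by (simp add: subordinator_def mult.commute)
    finally show ?case .
  qed
  also have "\<dots> = ennreal (1 / f s)"
    by (simp add: nn_integral_half_line nn_integral_exp_from_0[OF fs, simplified])
  finally show ?thesis .
qed

text \<open>In contrast to the infimum in \<open>inverse_process\<close>, this is measurable by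
  construction. It may be infinite.\<close>

definition occupation_time :: "real \<Rightarrow> 'a \<Rightarrow> ennreal" where
  "occupation_time x \<omega> = (\<integral>\<^sup>+t. indicator {..x} (regularized t \<omega>) \<partial>half_line)"

lemma measurable_occupation_time[measurable]: "occupation_time x \<in> borel_measurable M"
  unfolding occupation_time_def[abs_def] by measurable

lemma nn_integral_occupation_time:
  "(\<integral>\<^sup>+\<omega>. occupation_time x \<omega> \<partial>M) = emeasure potential_measure {..x}"
proof -
  interpret LM: pair_sigma_finite half_line M ..
  have "(\<integral>\<^sup>+\<omega>. occupation_time x \<omega> \<partial>M) = (\<integral>\<^sup>+t. \<integral>\<^sup>+\<omega>. indicator {..x} (regularized t \<omega>) \<partial>M \<partial>half_line)"
    unfolding occupation_time_def by (rule LM.Fubini') measurable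
  also have "\<dots> = (\<integral>\<^sup>+z. indicator {..x} z \<partial>potential_measure)"
    by (rule nn_integral_potential_measure[symmetric]) auto
  finally show ?thesis by simp
qed

text \<open>A finite expectation makes the occupation times finite almost surely, at all integer
  levels with a common null set. Such a path exceeds every level, since staying below one would take
  infinite time; hence the infimum is over a nonempty set. By monotonicity the times spent up to
  level \<open>x\<close> then form an interval from 0 to that infimum.\<close>

lemma occupation_time_eq_inverse:
  assumes "\<And>x. 0 \<le> x \<Longrightarrow> emeasure potential_measure {..x} < \<infinity>"
  shows "AE \<omega> in M. \<forall>x\<ge>0. {r. 0 \<le> r \<and> x < D r \<omega>} \<noteq> {} \<and>
      0 \<le> inverse_process D x \<omega> \<and> occupation_time x \<omega> = ennreal (inverse_process D x \<omega>)"
proof -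
  have "AE \<omega> in M. occupation_time (real n) \<omega> \<noteq> \<infinity>" for n
    using assms[of "real n"] by (intro nn_integral_PInf_AE) (auto simp: nn_integral_occupation_time)
  then have "AE \<omega> in M. \<forall>n. occupation_time (real n) \<omega> \<noteq> \<infinity>"
    by (simp add: AE_all_countable)
  with subordinator_mono AE_regularized AE_space show ?thesis
  proof eventually_elim
    case (elim \<omega>)
    note [measurable] = \<open>\<omega> \<in> space M\<close>
    have mono: "D r \<omega> \<le> D r' \<omega>" if "0 \<le> r" "r \<le> r'" for r r'
      using elim(1) that by (auto simp: mono_on_def)
    have occ: "occupation_time x \<omega> = (\<integral>\<^sup>+r. indicator {..x} (D r \<omega>) \<partial>half_line)" for x
      unfolding occupation_time_def using AE_half_line
      by (intro nn_integral_cong_AE) (use elim(2) in \<open>auto elim!: eventually_mono\<close>)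
    show ?case
    proof (intro allI impI conjI)
      fix x :: real assume x: "0 \<le> x"
      define S where "S = {r. 0 \<le> r \<and> x < D r \<omega>}"
      obtain n :: nat where n: "x \<le> real n"
        using real_arch_simple by blast
      show ne: "{r. 0 \<le> r \<and> x < D r \<omega>} \<noteq> {}"
      proof
        assume "{r. 0 \<le> r \<and> x < D r \<omega>} = {}"
        then have "D r \<omega> \<le> real n" if "0 \<le> r" for r
          using that n by force
        then have "occupation_time (real n) \<omega> = (\<integral>\<^sup>+r. 1 \<partial>half_line)"
          unfolding occ using AE_half_line
          by (intro nn_integral_cong_AE) (auto elim!: eventually_mono)
        also have "\<dots> = \<infinity>"
          using emeasure_half_line by (simp add: half_line_def)
        finally show False using elim(4) by simp
      qed
      then have S: "S \<noteq> {}" "bdd_below S" "S \<subseteq> {0..}"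
        by (auto simp: S_def intro!: bdd_belowI[of _ 0])
      have E: "inverse_process D x \<omega> = Inf S"
        by (simp add: inverse_process_def S_def)
      show nn: "0 \<le> inverse_process D x \<omega>"
        unfolding E using S by (intro cInf_greatest) auto
      have "occupation_time x \<omega> = (\<integral>\<^sup>+r. indicator {..Inf S} r \<partial>half_line)"
        unfolding occ
      \<comment> \<open>At \<open>r = Inf S\<close> monotonicity does not decide on which side of
        \<open>x\<close> the path lies; this single time is null.\<close>
      proof (rule nn_integral_cong_AE, use AE_half_line AE_half_line_neq[of "Inf S"] in eventually_elim)
        case (elim r)
        show ?case
        proof (cases "r < Inf S")
          case True
          then have "r \<notin> S" using S(2) cInf_lower by fastforce
          with True elim show ?thesis by (auto simp: S_def split: split_indicator)
        next
          case False
          then obtain r' where "r' \<in> S" "r' < r"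
            using elim S cInf_lessD[of S r] by auto
          then have "x < D r \<omega>" using mono[of r' r] by (auto simp: S_def)
          with False elim show ?thesis by (auto split: split_indicator)
        qed
      qed
      also have "\<dots> = (\<integral>\<^sup>+r. indicator {0..Inf S} r \<partial>lborel)"
        by (subst nn_integral_half_line)
           (auto intro!: nn_integral_cong split: split_indicator simp del: nn_integral_indicator)
      also have "\<dots> = ennreal (Inf S)"
        using nn E by simp
      finally show "occupation_time x \<omega> = ennreal (inverse_process D x \<omega>)"
        by (simp add: E)
    qed
  qed
qed

text \<open>With \<open>u = r + h\<close> the ordering becomes \<open>0 \<le> h\<close>, and
  \<open>D (r + h)\<close> has, jointly with \<open>D r\<close>, the law of \<open>D r\<close> plus
  an independent copy of \<open>D h\<close>. Integrating over \<open>h\<close> and then over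
  \<open>r\<close> produces one potential measure each.\<close>

lemma nn_integral_ordered_occupation:
  "(\<integral>\<^sup>+\<omega>. \<integral>\<^sup>+r. \<integral>\<^sup>+u. (if r \<le> u then indicator {..x} (regularized r \<omega>) * indicator {..y} (regularized u \<omega>) else 0)
       \<partial>half_line \<partial>half_line \<partial>M) =
   (\<integral>\<^sup>+a. \<integral>\<^sup>+b. indicator {..x} a * indicator {..y} (a + b) \<partial>potential_measure \<partial>potential_measure)"
proof -
  interpret LM: pair_sigma_finite half_line M ..
  define P where "P = (\<integral>\<^sup>+a. \<integral>\<^sup>+b. indicator {..x} a * indicator {..y} (a + b) \<partial>potential_measure \<partial>potential_measure :: ennreal)"
  let ?i = "\<lambda>r h \<omega>. indicator {..x} (regularized r \<omega>) * indicator {..y} (regularized (r + h) \<omega>) :: ennreal"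
  have "(\<integral>\<^sup>+\<omega>. \<integral>\<^sup>+r. \<integral>\<^sup>+u. (if r \<le> u then indicator {..x} (regularized r \<omega>) * indicator {..y} (regularized u \<omega>) else 0)
       \<partial>half_line \<partial>half_line \<partial>M) =
     (\<integral>\<^sup>+\<omega>. \<integral>\<^sup>+r. \<integral>\<^sup>+h. ?i r h \<omega> \<partial>half_line \<partial>half_line \<partial>M)"
  proof (rule nn_integral_cong, rule nn_integral_cong_AE)
    fix \<omega> assume [measurable]: "\<omega> \<in> space M"
    show "AE r in half_line. (\<integral>\<^sup>+u. (if r \<le> u then indicator {..x} (regularized r \<omega>) * indicator {..y} (regularized u \<omega>) else 0) \<partial>half_line) =
      (\<integral>\<^sup>+h. ?i r h \<omega> \<partial>half_line)"
      using AE_half_line by eventually_elim (rule nn_integral_half_line_shift, auto)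
  qed
  also have "\<dots> = (\<integral>\<^sup>+r. \<integral>\<^sup>+\<omega>. \<integral>\<^sup>+h. ?i r h \<omega> \<partial>half_line \<partial>M \<partial>half_line)"
    by (rule LM.Fubini') measurable
  also have "\<dots> = (\<integral>\<^sup>+r. \<integral>\<^sup>+h. \<integral>\<^sup>+\<omega>. ?i r h \<omega> \<partial>M \<partial>half_line \<partial>half_line)"
    by (intro nn_integral_cong LM.Fubini') measurable
  also have "\<dots> = (\<integral>\<^sup>+r. \<integral>\<^sup>+h. \<integral>\<^sup>+\<omega>'. \<integral>\<^sup>+\<omega>. indicator {..x} (regularized r \<omega>') * indicator {..y} (regularized r \<omega>' + regularized h \<omega>)
       \<partial>M \<partial>M \<partial>half_line \<partial>half_line)"
  proof (intro nn_integral_cong_AE, use AE_half_line in eventually_elim, intro nn_integral_cong_AE,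
         use AE_half_line in eventually_elim)
    fix r h :: real assume r: "0 \<le> r" and h: "0 \<le> h"
    \<comment> \<open>The increment law is known for \<open>D\<close>, whereas Tonelli needs
      \<open>regularized\<close>; at fixed times the two are exchanged and exchanged back.\<close>
    have "(\<integral>\<^sup>+\<omega>. ?i r h \<omega> \<partial>M) =
      (\<integral>\<^sup>+\<omega>. indicator {..x} (D r \<omega>) * indicator {..y} (D r \<omega> + (D (r + h) \<omega> - D r \<omega>)) \<partial>M)"
    proof (rule nn_integral_cong_AE)
      show "AE \<omega> in M. ?i r h \<omega> = indicator {..x} (D r \<omega>) * indicator {..y} (D r \<omega> + (D (r + h) \<omega> - D r \<omega>))"
        using AE_regularized by eventually_elim (use r h in auto)
    qed
    also have "\<dots> = (\<integral>\<^sup>+\<omega>'. \<integral>\<^sup>+\<omega>. indicator {..x} (D r \<omega>') * indicator {..y} (D r \<omega>' + D h \<omega>) \<partial>M \<partial>M)"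
      using r h by (intro levy_process_nn_integral_increment[OF subordinator_levy,
          where f="\<lambda>a b. indicator {..x} a * indicator {..y} (a + b)"]) auto
    also have "\<dots> = (\<integral>\<^sup>+\<omega>'. \<integral>\<^sup>+\<omega>. indicator {..x} (regularized r \<omega>') * indicator {..y} (regularized r \<omega>' + regularized h \<omega>) \<partial>M \<partial>M)"
    proof (rule nn_integral_cong_AE, use AE_regularized_at[OF r] in eventually_elim)
      fix \<omega>' assume "regularized r \<omega>' = D r \<omega>'"
      then show "(\<integral>\<^sup>+\<omega>. indicator {..x} (D r \<omega>') * indicator {..y} (D r \<omega>' + D h \<omega>) \<partial>M) =
        (\<integral>\<^sup>+\<omega>. indicator {..x} (regularized r \<omega>') * indicator {..y} (regularized r \<omega>' + regularized h \<omega>) \<partial>M)"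
        using AE_regularized_at[OF h] by (intro nn_integral_cong_AE) (auto elim!: eventually_mono)
    qed
    finally show "(\<integral>\<^sup>+\<omega>. ?i r h \<omega> \<partial>M) = \<dots>" .
  qed
  also have "\<dots> = (\<integral>\<^sup>+r. \<integral>\<^sup>+\<omega>'. \<integral>\<^sup>+h. \<integral>\<^sup>+\<omega>. indicator {..x} (regularized r \<omega>') * indicator {..y} (regularized r \<omega>' + regularized h \<omega>)
       \<partial>M \<partial>half_line \<partial>M \<partial>half_line)"
    by (intro nn_integral_cong LM.Fubini'[symmetric]) measurable
  also have "\<dots> = (\<integral>\<^sup>+r. \<integral>\<^sup>+\<omega>'. \<integral>\<^sup>+b. indicator {..x} (regularized r \<omega>') * indicator {..y} (regularized r \<omega>' + b)
       \<partial>potential_measure \<partial>M \<partial>half_line)"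
    by (intro nn_integral_cong nn_integral_potential_measure[symmetric]) measurable
  also have "\<dots> = P"
    unfolding P_def
  proof (rule nn_integral_potential_measure[symmetric])
    \<comment> \<open>Sigma-finiteness of \<open>potential_measure\<close> is not established for a
      general subordinator, so measurability in \<open>a\<close> is read off the iterated integral
      over the sigma-finite \<open>half_line\<close> and \<open>M\<close>.\<close>
    have "(\<lambda>a. \<integral>\<^sup>+b. indicator {..x} a * indicator {..y} (a + b) \<partial>potential_measure) =
      (\<lambda>a. \<integral>\<^sup>+t. \<integral>\<^sup>+\<omega>. indicator {..x} a * indicator {..y} (a + regularized t \<omega>) \<partial>M \<partial>half_line :: ennreal)"
      by (intro ext nn_integral_potential_measure) measurable
    also have "\<dots> \<in> borel_measurable borel"
      by measurable
    finally show "(\<lambda>a. \<integral>\<^sup>+b. indicator {..x} a * indicator {..y} (a + b) \<partial>potential_measure :: ennreal) \<in> borel_measurable borel" .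
  qed
  finally show ?thesis by (simp add: P_def)
qed

text \<open>The square of time pairs is cut along its diagonal. Counting \<open>r = u\<close> in
  both halves is harmless, as for each \<open>r\<close> it is a null set of \<open>u\<close>; the
  second half is the first with the levels exchanged.\<close>

lemma nn_integral_occupation_product:
  "(\<integral>\<^sup>+\<omega>. occupation_time x \<omega> * occupation_time y \<omega> \<partial>M) =
   (\<integral>\<^sup>+a. \<integral>\<^sup>+b. indicator {..x} a * indicator {..y} (a + b) \<partial>potential_measure \<partial>potential_measure) +
   (\<integral>\<^sup>+a. \<integral>\<^sup>+b. indicator {..y} a * indicator {..x} (a + b) \<partial>potential_measure \<partial>potential_measure)"
proof -
  interpret LL: pair_sigma_finite half_line half_line ..
  let ?A = "\<lambda>x y \<omega>. (\<integral>\<^sup>+r. \<integral>\<^sup>+u. (if r \<le> u then indicator {..x} (regularized r \<omega>) * indicator {..y} (regularized u \<omega>) else 0)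
       \<partial>half_line \<partial>half_line)"
  have "occupation_time x \<omega> * occupation_time y \<omega> = ?A x y \<omega> + ?A y x \<omega>" if "\<omega> \<in> space M" for \<omega>
  proof -
    note [measurable] = that
    let ?j = "\<lambda>r u. indicator {..x} (regularized r \<omega>) * indicator {..y} (regularized u \<omega>) :: ennreal"
    have "occupation_time x \<omega> * occupation_time y \<omega> = (\<integral>\<^sup>+r. \<integral>\<^sup>+u. ?j r u \<partial>half_line \<partial>half_line)"
      unfolding occupation_time_def by (simp add: nn_integral_cmult nn_integral_multc)
    also have "\<dots> = (\<integral>\<^sup>+r. \<integral>\<^sup>+u. (if r \<le> u then ?j r u else 0) + (if u \<le> r then ?j r u else 0) \<partial>half_line \<partial>half_line)"
    proof (rule nn_integral_cong, rule nn_integral_cong_AE)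
      fix r
      show "AE u in half_line. ?j r u = (if r \<le> u then ?j r u else 0) + (if u \<le> r then ?j r u else 0)"
        using AE_half_line_neq[of r] by eventually_elim auto
    qed
    also have "\<dots> = ?A x y \<omega> + (\<integral>\<^sup>+r. \<integral>\<^sup>+u. (if u \<le> r then ?j r u else 0) \<partial>half_line \<partial>half_line)"
      by (subst nn_integral_add[symmetric], measurable)
         (intro nn_integral_cong nn_integral_add; measurable)
    also have "(\<integral>\<^sup>+r. \<integral>\<^sup>+u. (if u \<le> r then ?j r u else 0) \<partial>half_line \<partial>half_line) =
       (\<integral>\<^sup>+u. \<integral>\<^sup>+r. (if u \<le> r then ?j r u else 0) \<partial>half_line \<partial>half_line)"
      by (rule LL.Fubini'[symmetric]) measurable
    also have "\<dots> = ?A y x \<omega>"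
      by (simp only: mult.commute)
    finally show ?thesis .
  qed
  then have "(\<integral>\<^sup>+\<omega>. occupation_time x \<omega> * occupation_time y \<omega> \<partial>M) = (\<integral>\<^sup>+\<omega>. ?A x y \<omega> + ?A y x \<omega> \<partial>M)"
    by (intro nn_integral_cong) auto
  also have "\<dots> = (\<integral>\<^sup>+\<omega>. ?A x y \<omega> \<partial>M) + (\<integral>\<^sup>+\<omega>. ?A y x \<omega> \<partial>M)"
    by (rule nn_integral_add) measurable
  finally show ?thesis
    unfolding nn_integral_ordered_occupation .
qed

end

end

section \<open>Moments of the fractional Poisson process\<close>

lemma inverse_process_mono:
  assumes "{r. 0 \<le> r \<and> y < D r \<omega>} \<noteq> {}" "x \<le> y"
  shows "inverse_process D x \<omega> \<le> inverse_process D y \<omega>"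
  unfolding inverse_process_def using assms
  by (intro cInf_superset_mono) (auto intro!: bdd_belowI[of _ 0])

text \<open>The inverse approaches its value at \<open>t\<close> from above: some \<open>r\<close>
  just beyond that value has \<open>t < D r \<omega>\<close>, and every level below
  \<open>D r \<omega>\<close> is passed by time \<open>r\<close>.\<close>

lemma continuous_at_right_compose_inverse_process:
  assumes ne: "\<And>x. t \<le> x \<Longrightarrow> {r. 0 \<le> r \<and> x < D r \<omega>} \<noteq> {}"
    and f: "continuous (at_right (inverse_process D t \<omega>)) f"
  shows "continuous (at_right t) (\<lambda>x. f (inverse_process D x \<omega>))"
  unfolding continuous_within
proof (rule topological_tendstoI)
  fix S assume S: "open S" "f (inverse_process D t \<omega>) \<in> S"
  have "eventually (\<lambda>u. f u \<in> S) (at_right (inverse_process D t \<omega>))"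
    using f S unfolding continuous_within by (rule topological_tendstoD)
  then obtain u where u: "inverse_process D t \<omega> < u"
    "\<And>z. inverse_process D t \<omega> < z \<Longrightarrow> z < u \<Longrightarrow> f z \<in> S"
    by (auto simp: eventually_at_right_field)
  obtain r where r: "0 \<le> r" "t < D r \<omega>" "r < u"
    using u(1) cInf_lessD[OF ne[OF order_refl]] by (auto simp: inverse_process_def)
  show "eventually (\<lambda>x. f (inverse_process D x \<omega>) \<in> S) (at_right t)"
    unfolding eventually_at_right_field
  proof (intro exI[of _ "D r \<omega>"] conjI allI impI)
    fix x assume x: "t < x" "x < D r \<omega>"
    have "inverse_process D x \<omega> \<le> r"
      unfolding inverse_process_def using r x
      by (intro cInf_lower) (auto intro!: bdd_belowI[of _ 0])
    moreover have "inverse_process D t \<omega> \<le> inverse_process D x \<omega>"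
      using ne[of x] x by (intro inverse_process_mono) auto
    \<comment> \<open>The inverse may be constant to the right of \<open>t\<close>; there the value
      of \<open>f\<close> at the limit point itself is used.\<close>
    ultimately show "f (inverse_process D x \<omega>) \<in> S"
      using u(2)[of "inverse_process D x \<omega>"] S(2) r(3)
      by (cases "inverse_process D x \<omega> = inverse_process D t \<omega>") auto
  qed (rule r(2))
qed

text \<open>Meant for \<open>x \<le> y\<close>. The term in \<open>x powr (2 * \<beta>)\<close> with
  the complete beta function stems from \<open>G(y, x)\<close>, the one in
  \<open>y powr (2 * \<beta>)\<close> from \<open>G(x, y)\<close>.\<close>

definition fpp_product_moment :: "real \<Rightarrow> real \<Rightarrow> real \<Rightarrow> real \<Rightarrow> real" where
  "fpp_product_moment \<beta> q x y = q * x powr \<beta> + q\<^sup>2 * \<beta> *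
     (x powr (2 * \<beta>) * incomplete_beta \<beta> (1 + \<beta>) 1 +
      y powr (2 * \<beta>) * incomplete_beta \<beta> (1 + \<beta>) (x / y))"

lemma fpp_product_moment_nonneg: "0 \<le> \<beta> \<Longrightarrow> 0 \<le> q \<Longrightarrow> 0 \<le> fpp_product_moment \<beta> q x y"
  unfolding fpp_product_moment_def
  by (intro add_nonneg_nonneg mult_nonneg_nonneg incomplete_beta_nonneg) auto

text \<open>No relation between \<open>x\<close> and \<open>y\<close> is involved, so the bound
  holds pointwise under the expectation and not merely almost surely.\<close>

lemma fpp_product_moment_1:
  \<comment> \<open>The two beta terms are \<open>x\<^sup>2 / 2\<close> and
    \<open>x * y - x\<^sup>2 / 2\<close>.\<close>
  assumes "0 \<le> x" "x \<le> y"
  shows "fpp_product_moment 1 q x y = q * x + q\<^sup>2 * (x * y)"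
proof (cases "y = 0")
  case False
  then show ?thesis
    using assms unfolding fpp_product_moment_def
    by (simp add: incomplete_beta_1_2 field_simps power2_eq_square powr_realpow[of _ 2, simplified])
next
  case True
  then show ?thesis using assms by (simp add: fpp_product_moment_def)
qed

context prob_space
begin

section \<open>Moments of the inverse stable subordinator\<close>

context
  fixes D :: "real \<Rightarrow> 'a \<Rightarrow> real" and \<beta> :: real
  assumes \<beta>: "0 < \<beta>" and D: "stable_subordinator \<beta> D"
begin

lemma stable_imp_subordinator: "subordinator (\<lambda>s. s powr \<beta>) D"
  using D by (simp add: stable_subordinator_def)

lemma potential_measure_stable: "potential_measure D = gamma_kernel \<beta>"
proof (rule laplace_unique)
  show "(\<integral>\<^sup>+x. ennreal (exp (- real (Suc n) * x)) \<partial>potential_measure D) =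
     (\<integral>\<^sup>+x. ennreal (exp (- real (Suc n) * x)) \<partial>gamma_kernel \<beta>)" for n
    by (subst potential_measure_laplace[OF stable_imp_subordinator])
       (simp_all add: gamma_kernel_laplace[OF \<beta>, of "real (Suc n)", simplified])
  show "(\<integral>\<^sup>+x. ennreal (exp (- x)) \<partial>potential_measure D) < \<infinity>"
    using potential_measure_laplace[OF stable_imp_subordinator, of 1] by simp
qed (simp_all add: sets_potential_measure[OF stable_imp_subordinator] sets_gamma_kernel AE_gamma_kernel_nonneg
       AE_potential_measure_nonneg[OF stable_imp_subordinator])

lemma inverse_stable:
  "AE \<omega> in M. \<forall>x\<ge>0. {r. 0 \<le> r \<and> x < D r \<omega>} \<noteq> {} \<and>
      0 \<le> inverse_process D x \<omega> \<and> occupation_time D x \<omega> = ennreal (inverse_process D x \<omega>)"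
  by (rule occupation_time_eq_inverse[OF stable_imp_subordinator])
     (simp add: potential_measure_stable emeasure_gamma_kernel[OF \<beta>])

lemma nn_integral_inverse_stable:
  assumes "0 \<le> x"
  shows "(\<integral>\<^sup>+\<omega>. ennreal (inverse_process D x \<omega>) \<partial>M) = ennreal (x powr \<beta> / Gamma (1 + \<beta>))"
proof -
  have "(\<integral>\<^sup>+\<omega>. ennreal (inverse_process D x \<omega>) \<partial>M) = (\<integral>\<^sup>+\<omega>. occupation_time D x \<omega> \<partial>M)"
    using assms by (intro nn_integral_cong_AE) (use inverse_stable in eventually_elim, simp)
  then show ?thesis
    using assms by (simp add: nn_integral_occupation_time[OF stable_imp_subordinator] potential_measure_stable
        emeasure_gamma_kernel[OF \<beta>])
qed

lemma nn_integral_inverse_stable_product: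
  assumes "0 \<le> x" "x \<le> y"
  shows "(\<integral>\<^sup>+\<omega>. ennreal (inverse_process D x \<omega> * inverse_process D y \<omega>) \<partial>M) =
    ennreal (\<beta> / (Gamma (1 + \<beta>))\<^sup>2 * (x powr (2 * \<beta>) * incomplete_beta \<beta> (1 + \<beta>) 1 +
      y powr (2 * \<beta>) * incomplete_beta \<beta> (1 + \<beta>) (x / y)))"
proof -
  have y: "0 \<le> y" using assms by simp
  let ?K = "gamma_kernel \<beta>"
  let ?g = "\<beta> / (Gamma (1 + \<beta>))\<^sup>2"
  have "(\<integral>\<^sup>+\<omega>. ennreal (inverse_process D x \<omega> * inverse_process D y \<omega>) \<partial>M) =
    (\<integral>\<^sup>+\<omega>. occupation_time D x \<omega> * occupation_time D y \<omega> \<partial>M)"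
    using assms(1) y by (intro nn_integral_cong_AE) (use inverse_stable in eventually_elim, simp add: ennreal_mult')
  also have "\<dots> =
    (\<integral>\<^sup>+a. \<integral>\<^sup>+b. indicator {..x} a * indicator {..y} (a + b) \<partial>?K \<partial>?K) +
    (\<integral>\<^sup>+a. \<integral>\<^sup>+b. indicator {..y} a * indicator {..x} (a + b) \<partial>?K \<partial>?K)"
    by (simp add: nn_integral_occupation_product[OF stable_imp_subordinator] potential_measure_stable)
  \<comment> \<open>Since \<open>b\<close> is nonnegative and \<open>x \<le> y\<close>, the
    condition \<open>a + b \<le> x\<close> already implies both \<open>a \<le> x\<close> and
    \<open>a \<le> y\<close>.\<close>
  also have "(\<integral>\<^sup>+a. \<integral>\<^sup>+b. indicator {..y} a * indicator {..x} (a + b) \<partial>?K \<partial>?K) =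
    (\<integral>\<^sup>+a. \<integral>\<^sup>+b. indicator {..x} a * indicator {..x} (a + b) \<partial>?K \<partial>?K :: ennreal)"
  proof (rule nn_integral_cong, rule nn_integral_cong_AE)
    fix a
    show "AE b in ?K. indicator {..y} a * indicator {..x} (a + b) = (indicator {..x} a * indicator {..x} (a + b) :: ennreal)"
      using AE_gamma_kernel_nonneg by eventually_elim (use assms in \<open>auto split: split_indicator\<close>)
  qed
  also have "\<dots> = ennreal (?g * (x powr (2 * \<beta>) * incomplete_beta \<beta> (1 + \<beta>) (x / x)))"
    by (rule gamma_kernel_convolution[OF \<beta> assms(1) order_refl])
  \<comment> \<open>For \<open>x = 0\<close> the quotient \<open>x / x\<close> is 0 and not 1, but
    the factor in front vanishes.\<close>
  also have "x powr (2 * \<beta>) * incomplete_beta \<beta> (1 + \<beta>) (x / x) = x powr (2 * \<beta>) * incomplete_beta \<beta> (1 + \<beta>) 1"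
    by (cases "x = 0") auto
  also have "(\<integral>\<^sup>+a. \<integral>\<^sup>+b. indicator {..x} a * indicator {..y} (a + b) \<partial>?K \<partial>?K) =
    ennreal (?g * (y powr (2 * \<beta>) * incomplete_beta \<beta> (1 + \<beta>) (x / y)))"
    by (rule gamma_kernel_convolution[OF \<beta> assms])
  finally show ?thesis
    using \<beta> by (simp add: ennreal_plus[symmetric] incomplete_beta_nonneg distrib_left add.commute del: ennreal_plus)
qed

end

section \<open>Path properties and moments of the fractional Poisson process\<close>

context
  fixes \<beta> lam :: real and N\<beta> :: "real \<Rightarrow> 'a \<Rightarrow> real"
  assumes \<beta>: "0 < \<beta>" and lam: "0 < lam"
    and N\<beta>: "fractional_poisson_process \<beta> lam N\<beta>"
begin

lemma fractional_poisson_cases: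
  obtains "\<beta> = 1" "poisson_process lam N\<beta>"
  | N D where "poisson_process lam N" "stable_subordinator \<beta> D"
      "indep_processes N (inverse_process D)"
      "\<And>t \<omega>. 0 \<le> t \<Longrightarrow> \<omega> \<in> space M \<Longrightarrow> N\<beta> t \<omega> = N (inverse_process D t \<omega>) \<omega>"
  using N\<beta> unfolding fractional_poisson_process_def by (auto split: if_splits)

text \<open>Makes it possible to freeze the time a second time, when this process is itself
  evaluated at the times of a subordinator.\<close>

lemma fractional_poisson_right_continuous:
  "AE \<omega> in M. \<forall>t\<ge>0. continuous (at_right t) (\<lambda>r. N\<beta> r \<omega>)"
proof (cases rule: fractional_poisson_cases)
  case 1
  then show ?thesis by (intro poisson_process_right_continuous[OF lam])
next
  case (2 N D)
  from poisson_process_right_continuous[OF lam 2(1)] inverse_stable[OF \<beta> 2(2)] AE_space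
  show ?thesis
  proof eventually_elim
    case (elim \<omega>)
    show ?case
    proof (intro allI impI)
      fix t :: real assume t: "0 \<le> t"
      have "continuous (at_right t) (\<lambda>r. N (inverse_process D r \<omega>) \<omega>)"
        using elim t by (intro continuous_at_right_compose_inverse_process) auto
      then show "continuous (at_right t) (\<lambda>r. N\<beta> r \<omega>)"
        unfolding continuous_within
      proof (rule Lim_transform_eventually[OF _ , of _ _ _ "\<lambda>r. N\<beta> r \<omega>", THEN tendsto_eq_rhs])
        show "eventually (\<lambda>r. N (inverse_process D r \<omega>) \<omega> = N\<beta> r \<omega>) (at_right t)"
          unfolding eventually_at_right_field
          using t elim(3) 2(4) by (intro exI[of _ "t + 1"]) auto
        show "N (inverse_process D t \<omega>) \<omega> = N\<beta> t \<omega>"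
          using t elim(3) 2(4) by simp
      qed
    qed
  qed
qed

lemma fractional_poisson_nonneg: "AE \<omega> in M. \<forall>t\<ge>0. 0 \<le> N\<beta> t \<omega>"
proof (cases rule: fractional_poisson_cases)
  case 1
  then show ?thesis by (intro poisson_process_nonneg[OF lam])
next
  case (2 N D)
  from poisson_process_nonneg[OF lam 2(1)] inverse_stable[OF \<beta> 2(2)] AE_space
  show ?thesis
    by eventually_elim (use 2(4) in auto)
qed

lemma fractional_poisson_mean:
  assumes t: "0 \<le> t"
  shows "(\<integral>\<^sup>+\<omega>. ennreal (N\<beta> t \<omega>) \<partial>M) = ennreal (lam / Gamma (1 + \<beta>) * t powr \<beta>)"
proof (cases rule: fractional_poisson_cases)
  case 1
  then show ?thesis
    using poisson_process_moments(1)[OF lam 1(2) t] t Gamma_fact[of 1, where ?'a=real] by simp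
next
  case (2 N D)
  note [measurable] = indep_processes_rv(2)[OF 2(3) t]
  have nn: "AE \<omega> in M. 0 \<le> inverse_process D t \<omega>"
    using inverse_stable[OF \<beta> 2(2)] by eventually_elim (use t in auto)
  have "(\<integral>\<^sup>+\<omega>. ennreal (N\<beta> t \<omega>) \<partial>M) = (\<integral>\<^sup>+\<omega>. ennreal (N (inverse_process D t \<omega>) \<omega>) \<partial>M)"
    using t 2(4) by (intro nn_integral_cong) auto
  also have "\<dots> = (\<integral>\<^sup>+\<omega>'. \<integral>\<^sup>+\<omega>. ennreal (N (inverse_process D t \<omega>') \<omega>) \<partial>M \<partial>M)"
    using t nn by (intro indep_processes_nn_integral[OF 2(3) poisson_process_right_continuous[OF lam 2(1)],
          where h="\<lambda>a b. ennreal a"]) auto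
  also have "\<dots> = (\<integral>\<^sup>+\<omega>'. ennreal lam * ennreal (inverse_process D t \<omega>') \<partial>M)"
    by (rule nn_integral_cong_AE, use nn in eventually_elim)
      (simp add: poisson_process_moments[OF lam 2(1)] ennreal_mult' lam less_imp_le)
  also have "\<dots> = ennreal lam * ennreal (t powr \<beta> / Gamma (1 + \<beta>))"
    by (simp add: nn_integral_cmult nn_integral_inverse_stable[OF \<beta> 2(2) t])
  finally show ?thesis
    using lam by (simp add: ennreal_mult'[symmetric])
qed

text \<open>For frozen times \<open>a \<le> b\<close> the Poisson product moment is
  \<open>lam * a + lam\<^sup>2 * (a * b)\<close>; it applies because the inverse process is
  monotone. What remains is the mean and the product moment of the inverse.\<close>

lemma fractional_poisson_product_moment:
  assumes xy: "0 \<le> x" "x \<le> y"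
  shows "(\<integral>\<^sup>+\<omega>. ennreal (N\<beta> x \<omega> * N\<beta> y \<omega>) \<partial>M) =
    ennreal (fpp_product_moment \<beta> (lam / Gamma (1 + \<beta>)) x y)"
proof (cases rule: fractional_poisson_cases)
  case 1
  then show ?thesis
    using poisson_process_product_moment[OF lam 1(2) xy] Gamma_fact[of 1, where ?'a=real] fpp_product_moment_1[OF xy] by simp
next
  case (2 N D)
  have y: "0 \<le> y" using xy by simp
  note [measurable] = indep_processes_rv(2)[OF 2(3) xy(1)] indep_processes_rv(2)[OF 2(3) y]
  let ?E = "inverse_process D"
  have G: "0 < Gamma (1 + \<beta>)" using \<beta> by (intro Gamma_real_pos) simp
  have nn: "AE \<omega> in M. 0 \<le> ?E x \<omega>" "AE \<omega> in M. 0 \<le> ?E y \<omega>" "AE \<omega> in M. ?E x \<omega> \<le> ?E y \<omega>"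
    using inverse_stable[OF \<beta> 2(2)]
    by (eventually_elim, use xy y inverse_process_mono[where D=D] in auto)+
  have "(\<integral>\<^sup>+\<omega>. ennreal (N\<beta> x \<omega> * N\<beta> y \<omega>) \<partial>M) = (\<integral>\<^sup>+\<omega>. ennreal (N (?E x \<omega>) \<omega> * N (?E y \<omega>) \<omega>) \<partial>M)"
    using xy y 2(4) by (intro nn_integral_cong) auto
  also have "\<dots> = (\<integral>\<^sup>+\<omega>'. \<integral>\<^sup>+\<omega>. ennreal (N (?E x \<omega>') \<omega> * N (?E y \<omega>') \<omega>) \<partial>M \<partial>M)"
    using xy y nn by (intro indep_processes_nn_integral[OF 2(3) poisson_process_right_continuous[OF lam 2(1)],
          where h="\<lambda>a b. ennreal (a * b)"]) auto
  also have "\<dots> = (\<integral>\<^sup>+\<omega>'. ennreal lam * ennreal (?E x \<omega>') + ennreal (lam\<^sup>2) * ennreal (?E x \<omega>' * ?E y \<omega>') \<partial>M)"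
    by (rule nn_integral_cong_AE, use nn in eventually_elim)
      (simp add: poisson_process_product_moment[OF lam 2(1)] ennreal_mult'[symmetric] lam less_imp_le)
  also have "\<dots> = ennreal lam * ennreal (x powr \<beta> / Gamma (1 + \<beta>)) +
     ennreal (lam\<^sup>2) * ennreal (\<beta> / (Gamma (1 + \<beta>))\<^sup>2 * (x powr (2 * \<beta>) * incomplete_beta \<beta> (1 + \<beta>) 1 +
      y powr (2 * \<beta>) * incomplete_beta \<beta> (1 + \<beta>) (x / y)))"
    by (simp only: nn_integral_inverse_stable[OF \<beta> 2(2) xy(1), symmetric]
          nn_integral_inverse_stable_product[OF \<beta> 2(2) xy, symmetric])
       (subst nn_integral_add; simp add: nn_integral_cmult)
  also have "\<dots> = ennreal (fpp_product_moment \<beta> (lam / Gamma (1 + \<beta>)) x y)"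
    using lam \<beta> G unfolding fpp_product_moment_def
    by (simp add: ennreal_mult'[symmetric] ennreal_plus[symmetric] incomplete_beta_nonneg power_divide mult_ac
         del: ennreal_plus)
  finally show ?thesis .
qed

end

text \<open>Turns an \<open>ennreal\<close> computation into integrability and the expectation at
  once.\<close>

lemma nn_integral_eq_imp_integrable_expectation:
  assumes "random_variable borel X" "AE \<omega> in M. 0 \<le> X \<omega>"
    and "(\<integral>\<^sup>+\<omega>. ennreal (X \<omega>) \<partial>M) = ennreal c" "0 \<le> c"
  shows "integrable M X" "expectation X = c"
  using has_bochner_integral_nn_integral[OF assms(1,2,4,3)]
  by (auto simp: has_bochner_integral_iff)

lemma covariance_eq:
  assumes "integrable M X" "integrable M Y" "integrable M (\<lambda>\<omega>. X \<omega> * Y \<omega>)"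
  shows "covariance X Y = expectation (\<lambda>\<omega>. X \<omega> * Y \<omega>) - expectation X * expectation Y"
proof -
  have "covariance X Y = expectation (\<lambda>\<omega>. X \<omega> * Y \<omega> - X \<omega> * expectation Y - expectation X * Y \<omega>
     + expectation X * expectation Y)"
    unfolding covariance_def by (intro Bochner_Integration.integral_cong) (auto simp: algebra_simps)
  also have "\<dots> = expectation (\<lambda>\<omega>. X \<omega> * Y \<omega>) - expectation X * expectation Y"
    using assms by (simp add: prob_space)
  finally show ?thesis .
qed

end

section \<open>Moments after the time change by a general subordinator\<close>

theorem theorem3p2:
  fixes M :: "'a measure"
    and N\<beta> D Q :: "real \<Rightarrow> 'a \<Rightarrow> real"
    and \<nu> :: "real measure"
    and \<beta> lam b q d s t :: real
  assumes "prob_space M"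
    and "0 < \<beta>" "\<beta> \<le> 1" "0 < lam"
    and "prob_space.fractional_poisson_process M \<beta> lam N\<beta>"
    and "0 \<le> b" "levy_measure \<nu>" "emeasure \<nu> {0<..} = \<infinity>"
    and "prob_space.subordinator M (bernstein_fun b \<nu>) D"
    and "prob_space.indep_processes M N\<beta> D"
    and "\<And>r \<rho>. 0 \<le> r \<Longrightarrow> 0 < \<rho> \<Longrightarrow> integrable M (\<lambda>\<omega>. D r \<omega> powr \<rho>)"
    and "\<And>r \<omega>. 0 \<le> r \<Longrightarrow> \<omega> \<in> space M \<Longrightarrow> Q r \<omega> = N\<beta> (D r \<omega>) \<omega>"
    and "prob_space.stochastic_process M Q"
    and "0 < s" "s \<le> t"
    and "q = lam / Gamma (1 + \<beta>)"
    and "d = \<beta> * q\<^sup>2 * incomplete_beta \<beta> (1 + \<beta>) 1"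
  shows "(integrable M (Q t) \<and>
         prob_space.expectation M (Q t) = q * prob_space.expectation M (\<lambda>\<omega>. D t \<omega> powr \<beta>)) \<and>
         (integrable M (\<lambda>\<omega>. (Q t \<omega>)\<^sup>2) \<and>
         prob_space.variance M (Q t) =
           q * prob_space.expectation M (\<lambda>\<omega>. D t \<omega> powr \<beta>)
             * (1 - q * prob_space.expectation M (\<lambda>\<omega>. D t \<omega> powr \<beta>))
           + 2 * d * prob_space.expectation M (\<lambda>\<omega>. D t \<omega> powr (2 * \<beta>))) \<and>
         (integrable M (\<lambda>\<omega>. Q s \<omega> * Q t \<omega>) \<and>
         integrable M (\<lambda>\<omega>. D t \<omega> powr (2 * \<beta>) * incomplete_beta \<beta> (1 + \<beta>) (D s \<omega> / D t \<omega>)) \<and>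
         prob_space.covariance M (Q s) (Q t) =
           q * prob_space.expectation M (\<lambda>\<omega>. D s \<omega> powr \<beta>)
           + d * prob_space.expectation M (\<lambda>\<omega>. D s \<omega> powr (2 * \<beta>))
           - q\<^sup>2 * prob_space.expectation M (\<lambda>\<omega>. D s \<omega> powr \<beta>)
               * prob_space.expectation M (\<lambda>\<omega>. D t \<omega> powr \<beta>)
           + q\<^sup>2 * \<beta> * prob_space.expectation M
               (\<lambda>\<omega>. D t \<omega> powr (2 * \<beta>) * incomplete_beta \<beta> (1 + \<beta>) (D s \<omega> / D t \<omega>)))"
proof -
  interpret prob_space M by fact
  note \<beta> = \<open>0 < \<beta>\<close> and lam = \<open>0 < lam\<close> and fpp = assms(5) and D = assms(9) and ind = assms(10)
  have s: "0 \<le> s" and t: "0 \<le> t"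
    using assms(14,15) by auto
  have G: "0 < Gamma (1 + \<beta>)"
    using \<beta> by (intro Gamma_real_pos) simp
  have q: "0 \<le> q"
    unfolding \<open>q = _\<close> using lam G by simp
  \<comment> \<open>\<open>Q r\<close> agrees only almost surely with an evaluation through
    \<open>right_value\<close>, so its measurability is taken from the hypothesis on
    \<open>Q\<close>.\<close>
  have rv: "random_variable borel (D r)" "random_variable borel (Q r)" if "0 \<le> r" for r
    using indep_processes_rv(2)[OF ind that] assms(13) that by (auto simp: stochastic_process_def)
  note [measurable] = rv[OF s] rv[OF t]
  have Dnn: "AE \<omega> in M. 0 \<le> D r \<omega>" if "0 \<le> r" for r
    using subordinator_nonneg[OF D] by eventually_elim (use that in auto)
  have Dst: "AE \<omega> in M. D s \<omega> \<le> D t \<omega>"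
    using subordinator_mono[OF D] by eventually_elim (use s assms(15) in \<open>auto intro: mono_onD\<close>)
  have Qnn: "AE \<omega> in M. 0 \<le> Q r \<omega>" if "0 \<le> r" for r
    using fractional_poisson_nonneg[OF \<beta> lam fpp] Dnn[OF that] AE_space
    by eventually_elim (use that assms(12) in auto)
  have Dint: "integrable M (\<lambda>\<omega>. D r \<omega> powr \<beta>)" "integrable M (\<lambda>\<omega>. D r \<omega> powr (2 * \<beta>))" if "0 \<le> r" for r
    using assms(11)[OF that] \<beta> by auto

  have mean: "integrable M (Q r)" "expectation (Q r) = q * expectation (\<lambda>\<omega>. D r \<omega> powr \<beta>)"
    if r: "0 \<le> r" for r
  proof -
    have "(\<integral>\<^sup>+\<omega>. ennreal (Q r \<omega>) \<partial>M) = (\<integral>\<^sup>+\<omega>. ennreal (N\<beta> (D r \<omega>) \<omega>) \<partial>M)"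
      using r assms(12) by (intro nn_integral_cong) auto
    also have "\<dots> = (\<integral>\<^sup>+\<omega>'. \<integral>\<^sup>+\<omega>. ennreal (N\<beta> (D r \<omega>') \<omega>) \<partial>M \<partial>M)"
      using r Dnn[OF r]
      by (intro indep_processes_nn_integral[OF ind fractional_poisson_right_continuous[OF \<beta> lam fpp],
            where h="\<lambda>a b. ennreal a"]) auto
    also have "\<dots> = (\<integral>\<^sup>+\<omega>'. ennreal (q * D r \<omega>' powr \<beta>) \<partial>M)"
      by (rule nn_integral_cong_AE, use Dnn[OF r] in eventually_elim)
         (simp add: fractional_poisson_mean[OF \<beta> lam fpp] \<open>q = _\<close>)
    also have "\<dots> = ennreal (expectation (\<lambda>\<omega>. q * D r \<omega> powr \<beta>))"
      using Dint(1)[OF r] q by (intro nn_integral_eq_integral) auto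
    finally have *: "(\<integral>\<^sup>+\<omega>. ennreal (Q r \<omega>) \<partial>M) = ennreal (q * expectation (\<lambda>\<omega>. D r \<omega> powr \<beta>))"
      by simp
    have "0 \<le> q * expectation (\<lambda>\<omega>. D r \<omega> powr \<beta>)"
      using q by (intro mult_nonneg_nonneg integral_nonneg_AE) auto
    from nn_integral_eq_imp_integrable_expectation[OF rv(2)[OF r] Qnn[OF r] * this]
    show "integrable M (Q r)" "expectation (Q r) = q * expectation (\<lambda>\<omega>. D r \<omega> powr \<beta>)" .
  qed

  let ?B = "\<lambda>r u \<omega>. D u \<omega> powr (2 * \<beta>) * incomplete_beta \<beta> (1 + \<beta>) (D r \<omega> / D u \<omega>)"
  \<comment> \<open>The pair is kept general, with the order required only almost surely, since the
    pair \<open>s\<close>, \<open>t\<close> yields the covariance and the pair \<open>t\<close>,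
    \<open>t\<close> the variance.\<close>
  have product: "integrable M (\<lambda>\<omega>. Q r \<omega> * Q u \<omega>)" "integrable M (?B r u)"
    "expectation (\<lambda>\<omega>. Q r \<omega> * Q u \<omega>) = q * expectation (\<lambda>\<omega>. D r \<omega> powr \<beta>)
       + d * expectation (\<lambda>\<omega>. D r \<omega> powr (2 * \<beta>)) + q\<^sup>2 * \<beta> * expectation (?B r u)"
    if r: "0 \<le> r" and u: "0 \<le> u" and ru: "AE \<omega> in M. D r \<omega> \<le> D u \<omega>" for r u
  proof -
    note [measurable] = rv[OF r] rv[OF u]
    let ?m = "\<lambda>\<omega>. fpp_product_moment \<beta> q (D r \<omega>) (D u \<omega>)"
    \<comment> \<open>The quotient is almost surely at most 1 (and 0 where \<open>D u\<close>
      vanishes), so the incomplete beta function is dominated by the complete one, and the moment of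
      order \<open>2 * \<beta>\<close> is finite.\<close>
    show B: "integrable M (?B r u)"
    proof (rule Bochner_Integration.integrable_bound)
      show "integrable M (\<lambda>\<omega>. D u \<omega> powr (2 * \<beta>) * incomplete_beta \<beta> (1 + \<beta>) 1)"
        using Dint(2)[OF u] by auto
      show "AE \<omega> in M. norm (?B r u \<omega>) \<le> norm (D u \<omega> powr (2 * \<beta>) * incomplete_beta \<beta> (1 + \<beta>) 1)"
        using ru Dnn[OF r] Dnn[OF u]
      proof eventually_elim
        case (elim \<omega>)
        then have "D r \<omega> / D u \<omega> \<le> 1"
          by (cases "D u \<omega> = 0") (auto simp: divide_le_eq)
        then show ?case
          using \<beta> incomplete_beta_le[of \<beta> "1 + \<beta>"]
          by (auto simp: incomplete_beta_nonneg abs_mult intro!: mult_left_mono)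
      qed
    qed measurable
    have m: "integrable M ?m"
      unfolding fpp_product_moment_def using Dint[OF r] B by auto
    have nonneg: "AE \<omega> in M. 0 \<le> Q r \<omega> * Q u \<omega>"
      using Qnn[OF r] Qnn[OF u] by eventually_elim auto
    have "(\<integral>\<^sup>+\<omega>. ennreal (Q r \<omega> * Q u \<omega>) \<partial>M) = (\<integral>\<^sup>+\<omega>. ennreal (N\<beta> (D r \<omega>) \<omega> * N\<beta> (D u \<omega>) \<omega>) \<partial>M)"
      using r u assms(12) by (intro nn_integral_cong) auto
    also have "\<dots> = (\<integral>\<^sup>+\<omega>'. \<integral>\<^sup>+\<omega>. ennreal (N\<beta> (D r \<omega>') \<omega> * N\<beta> (D u \<omega>') \<omega>) \<partial>M \<partial>M)"
      using r u Dnn[OF r] Dnn[OF u]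
      by (intro indep_processes_nn_integral[OF ind fractional_poisson_right_continuous[OF \<beta> lam fpp],
            where h="\<lambda>a b. ennreal (a * b)"]) auto
    also have "\<dots> = (\<integral>\<^sup>+\<omega>'. ennreal (?m \<omega>') \<partial>M)"
      by (rule nn_integral_cong_AE, use Dnn[OF r] ru in eventually_elim)
         (simp add: fractional_poisson_product_moment[OF \<beta> lam fpp] \<open>q = _\<close>)
    also have "\<dots> = ennreal (expectation ?m)"
      using m \<beta> q by (intro nn_integral_eq_integral) (auto intro!: fpp_product_moment_nonneg)
    finally have *: "(\<integral>\<^sup>+\<omega>. ennreal (Q r \<omega> * Q u \<omega>) \<partial>M) = ennreal (expectation ?m)" .
    have "0 \<le> expectation ?m"
      using \<beta> q by (intro integral_nonneg_AE) (auto intro!: fpp_product_moment_nonneg)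
    note Q = nn_integral_eq_imp_integrable_expectation[OF _ nonneg * this]
    show "integrable M (\<lambda>\<omega>. Q r \<omega> * Q u \<omega>)"
      by (rule Q(1)) measurable
    have "expectation (\<lambda>\<omega>. Q r \<omega> * Q u \<omega>) = expectation ?m"
      by (rule Q(2)) measurable
    also have "\<dots> = q * expectation (\<lambda>\<omega>. D r \<omega> powr \<beta>)
       + d * expectation (\<lambda>\<omega>. D r \<omega> powr (2 * \<beta>)) + q\<^sup>2 * \<beta> * expectation (?B r u)"
      unfolding fpp_product_moment_def \<open>d = _\<close> using Dint[OF r] B by (simp add: algebra_simps)
    finally show "expectation (\<lambda>\<omega>. Q r \<omega> * Q u \<omega>) = \<dots>" .
  qed

  \<comment> \<open>Where \<open>D t\<close> vanishes the quotient is 0 and not 1, but the power in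
    front vanishes too.\<close>
  have diag: "D t \<omega> powr (2 * \<beta>) * incomplete_beta \<beta> (1 + \<beta>) (D t \<omega> / D t \<omega>) =
      incomplete_beta \<beta> (1 + \<beta>) 1 * D t \<omega> powr (2 * \<beta>)" for \<omega>
    by (cases "D t \<omega> = 0") auto
  note square = product[OF t t, simplified diag, simplified]
  have Q2: "integrable M (\<lambda>\<omega>. (Q t \<omega>)\<^sup>2)"
    using square(1) by (simp add: power2_eq_square)
  have "variance (Q t) = expectation (\<lambda>\<omega>. (Q t \<omega>)\<^sup>2) - (expectation (Q t))\<^sup>2"
    by (rule variance_eq[OF mean(1)[OF t] Q2])
  \<comment> \<open>At equal times both beta terms are complete and coincide, hence
    \<open>2 * d\<close>.\<close>
  also have "expectation (\<lambda>\<omega>. (Q t \<omega>)\<^sup>2) =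
      q * expectation (\<lambda>\<omega>. D t \<omega> powr \<beta>) + 2 * d * expectation (\<lambda>\<omega>. D t \<omega> powr (2 * \<beta>))"
    using square(3) \<open>d = _\<close> by (simp add: power2_eq_square)
  finally have variance: "variance (Q t) =
      q * expectation (\<lambda>\<omega>. D t \<omega> powr \<beta>) * (1 - q * expectation (\<lambda>\<omega>. D t \<omega> powr \<beta>))
      + 2 * d * expectation (\<lambda>\<omega>. D t \<omega> powr (2 * \<beta>))"
    by (simp add: mean(2)[OF t] power2_eq_square algebra_simps)
  have "covariance (Q s) (Q t) = expectation (\<lambda>\<omega>. Q s \<omega> * Q t \<omega>) - expectation (Q s) * expectation (Q t)"
    by (rule covariance_eq[OF mean(1)[OF s] mean(1)[OF t] product(1)[OF s t Dst]])
  then have "covariance (Q s) (Q t) = q * expectation (\<lambda>\<omega>. D s \<omega> powr \<beta>)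
      + d * expectation (\<lambda>\<omega>. D s \<omega> powr (2 * \<beta>))
      - q\<^sup>2 * expectation (\<lambda>\<omega>. D s \<omega> powr \<beta>) * expectation (\<lambda>\<omega>. D t \<omega> powr \<beta>)
      + q\<^sup>2 * \<beta> * expectation (?B s t)"
    by (simp add: mean(2)[OF s] mean(2)[OF t] product(3)[OF s t Dst] power2_eq_square)
  with mean[OF t] Q2 variance product(1,2)[OF s t Dst] show ?thesis
    by blast
qed

end
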